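(* Let $(X,Y)$ be a pair of real-valued random variables whose distribution $R$ is TP2. Let $Q$ be the distribution of $Y$, let $\mathcal{X}$ be the range of $X$, and set \[ \mathcal{X}_o:=\{x\in\mathcal{X}: S^{\rm nw}(x)\le S^{\rm se}(x)\}. \] Let $S:\mathcal{X}_o\to\mathbb{R}$ be an arbitrary isotonic function such that $S^{\rm nw}(x)\le S(x)\le S^{\rm se}(x)$ for all $x\in\mathcal{X}_o$. Then there exists a stochastic kernel $K$ describing the conditional distribution of $Y$ given $X$ such that $K(x_1,\cdot)\le_{\rm lr}K(x_2,\cdot)$ for arbitrary $x_1,x_2\in\mathcal{X}$ with $x_1<x_2$, and which has the following properties: (a) If $x\in\mathcal{X}_o$, then $K(x,\cdot)=\delta_{S(x)}$. (b) If $x\in\mathcal{X}\setminus\mathcal{X}_o$, then $K(x,\cdot)$ has a bounded density $h(x,\cdot)$ with respect to $Q$ such that $h(x,y)=0$ if $y<S^{\rm se}(x)$ or $y>S^{\rm nw}(x)$. Moreover, $h$ is TP2 on the set $(\mathcal{X}\setminus\mathcal{X}_o)\times\mathbb{R}$, that is, \[ h(x_2,y_1)h(x_1,y_2)\ \le\ h(x_1,y_1)h(x_2,y_2) \] for arbitrary numbers $x_1<x_2$ in $\mathcal{X}\setminus\mathcal{X}_o$ and real numbers $y_1<y_2$.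
   Context: $\mathcal{B}$ is the Borel $\sigma$-field on $\mathbb{R}$, $\bar{\mathbb{R}}:=[-\infty,\infty]$, $\delta_s$ is Dirac measure at $s$, "isotonic" means non-decreasing, and $A_1<A_2$ for sets means $a_1<a_2$ for all $a_1\in A_1,a_2\in A_2$. A probability distribution $R$ on $\mathbb{R}\times\mathbb{R}$ is TP2 (totally positive of order two) if $R(A_2\times B_1)R(A_1\times B_2)\le R(A_1\times B_1)R(A_2\times B_2)$ for arbitrary Borel sets $A_1<A_2$ and $B_1<B_2$. Range of $X$: $\mathcal{X}:=\{x\in\mathbb{R}:\mathbb{P}(X\le x)>0\text{ and }\mathbb{P}(X\ge x)>0\}$. For $x\in\mathbb{R}$: $S^{\rm nw}(x):=\min\{y\in\bar{\mathbb{R}}:\mathbb{P}(X\le x,Y>y)=0\}$ and $S^{\rm se}(x):=\max\{y\in\bar{\mathbb{R}}:\mathbb{P}(X\ge x,Y<y)=0\}$; these are isotonic functions $\mathbb{R}\to\bar{\mathbb{R}}$, and on $\mathcal{X}$ one has $S^{\rm nw}>-\infty$ and $S^{\rm se}<\infty$. A stochastic kernel describing the conditional distribution of $Y$ given $X$ is a map $K:\mathbb{R}\times\mathcal{B}\to[0,1]$ such that $K(x,\cdot)$ is a probability measure for every $x\in\mathbb{R}$, $K(\cdot,B)$ is measurable for every $B\in\mathcal{B}$, and $R(A\times B)=\int_A K(x,B)\,P(\mathrm{d}x)$ for all $A,B\in\mathcal{B}$, where $P$ is the distribution of $X$. Likelihood ratio order: $Q_1\le_{\rm lr}Q_2$ means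 that there exist a $\sigma$-finite measure $\mu$ on $\mathbb{R}$ and densities $g_j=\mathrm{d}Q_j/\mathrm{d}\mu:\mathbb{R}\to[0,\infty)$ ($j=1,2$) such that $g_2/g_1$ (with values in $[0,\infty]$, $c/0:=\infty$ for $c>0$) is non-decreasing on $\{g_1+g_2>0\}$. *)

theory Defs
  imports "HOL-Probability.Probability"
begin

definition set_less :: "'a::linorder set \<Rightarrow> 'a set \<Rightarrow> bool" where
  "set_less A1 A2 \<longleftrightarrow> (\<forall>a1\<in>A1. \<forall>a2\<in>A2. a1 < a2)"

definition TP2_distribution :: "(real \<times> real) measure \<Rightarrow> bool" where
  "TP2_distribution R \<longleftrightarrow>
     (\<forall>A1\<in>sets borel. \<forall>A2\<in>sets borel. \<forall>B1\<in>sets borel. \<forall>B2\<in>sets borel.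
        set_less A1 A2 \<longrightarrow> set_less B1 B2 \<longrightarrow>
        measure R (A2 \<times> B1) * measure R (A1 \<times> B2)
          \<le> measure R (A1 \<times> B1) * measure R (A2 \<times> B2))"

definition joint_distr :: "'a measure \<Rightarrow> ('a \<Rightarrow> real) \<Rightarrow> ('a \<Rightarrow> real) \<Rightarrow> (real \<times> real) measure" where
  "joint_distr M X Y = distr M (borel \<Otimes>\<^sub>M borel) (\<lambda>\<omega>. (X \<omega>, Y \<omega>))"

definition rv_range :: "'a measure \<Rightarrow> ('a \<Rightarrow> real) \<Rightarrow> real set" where
  "rv_range M X = {x. \<P>(\<omega> in M. X \<omega> \<le> x) > 0 \<and> \<P>(\<omega> in M. X \<omega> \<ge> x) > 0}"

(* The minimum and maximum over the extended reals are attained for every x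
   when M is a probability space and X, Y are measurable. *)

definition S_nw :: "'a measure \<Rightarrow> ('a \<Rightarrow> real) \<Rightarrow> ('a \<Rightarrow> real) \<Rightarrow> real \<Rightarrow> ereal" where
  "S_nw M X Y x = (LEAST y. \<P>(\<omega> in M. X \<omega> \<le> x \<and> ereal (Y \<omega>) > y) = 0)"

definition S_se :: "'a measure \<Rightarrow> ('a \<Rightarrow> real) \<Rightarrow> ('a \<Rightarrow> real) \<Rightarrow> real \<Rightarrow> ereal" where
  "S_se M X Y x = (GREATEST y. \<P>(\<omega> in M. X \<omega> \<ge> x \<and> ereal (Y \<omega>) < y) = 0)"

definition range_o :: "'a measure \<Rightarrow> ('a \<Rightarrow> real) \<Rightarrow> ('a \<Rightarrow> real) \<Rightarrow> real set" where
  "range_o M X Y = {x \<in> rv_range M X. S_nw M X Y x \<le> S_se M X Y x}"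

definition cond_distr_kernel ::
    "'a measure \<Rightarrow> ('a \<Rightarrow> real) \<Rightarrow> ('a \<Rightarrow> real) \<Rightarrow> (real \<Rightarrow> real measure) \<Rightarrow> bool" where
  "cond_distr_kernel M X Y K \<longleftrightarrow>
     K \<in> borel \<rightarrow>\<^sub>M prob_algebra borel \<and>
     (\<forall>A\<in>sets borel. \<forall>B\<in>sets borel.
        emeasure (joint_distr M X Y) (A \<times> B) = (\<integral>\<^sup>+x\<in>A. emeasure (K x) B \<partial>distr M borel X))"

(* Division on ennreal satisfies c / 0 = top for c > 0; the case 0 / 0 does not
   occur on the set {g1 + g2 > 0}. *)

definition lr_le :: "real measure \<Rightarrow> real measure \<Rightarrow> bool" where
  "lr_le Q1 Q2 \<longleftrightarrow>
     (\<exists>(\<mu> :: real measure) (g1 :: real \<Rightarrow> real) (g2 :: real \<Rightarrow> real).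
        sigma_finite_measure \<mu> \<and> sets \<mu> = sets borel \<and>
        g1 \<in> borel_measurable borel \<and> g2 \<in> borel_measurable borel \<and>
        (\<forall>y. 0 \<le> g1 y) \<and> (\<forall>y. 0 \<le> g2 y) \<and>
        Q1 = density \<mu> (\<lambda>y. ennreal (g1 y)) \<and> Q2 = density \<mu> (\<lambda>y. ennreal (g2 y)) \<and>
        mono_on {y. g1 y + g2 y > 0} (\<lambda>y. ennreal (g2 y) / ennreal (g1 y)))"

end

theory Submission
  imports Defs
begin

text \<open>
  Write \<open>I\<^sub>n(x) = (x - 1/(n+1), x]\<close>. By TP2 the law of \<open>Y\<close> given \<open>X \<in> A\<close> grows stochastically with
  \<open>A\<close>, so \<open>P(Y \<le> c | X \<in> I\<^sub>n(x))\<close> decreases in \<open>n\<close> and has a limit for \<^emph>\<open>every\<close> \<open>x\<close>; a differentiation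
  argument with the one-sided intervals \<open>I\<^sub>n\<close> shows that the limit disintegrates the joint law. At a
  point \<open>a\<close> with \<open>S_se a < S_nw a\<close>, TP2 bounds the limit law by a multiple of the law \<open>Q\<close> of \<open>Y\<close>. Its
  density is the limit of the ratios over \<open>I\<^sub>m(y)\<close>, which again exists for every \<open>y\<close>: if \<open>Q\<close> is split
  into the part coming from \<open>X \<le> a\<close> and the part coming from \<open>X > a\<close>, both parts have monotone ratios
  to the limit law. Being a pointwise limit of ratios of TP2 masses, the density is TP2 everywhere.
  Points \<open>x\<close> in a gap of the distribution of \<open>X\<close> use the left end \<open>a\<close> of the gap, and the law is
  conditioned on \<open>[S_se x, S_nw x]\<close>, which changes nothing for almost every \<open>x\<close>.
\<close>

section \<open>Differentiation of measures along left neighbourhoods\<close>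

text \<open>A version of the conditional law that is fixed only almost everywhere cannot work,
  because the likelihood ratio order and the TP2 inequality for \<open>h\<close> are demanded at
  every pair of points. Hence laws and densities are defined by limits existing everywhere, and
  differentiation only confirms that they are versions of the right objects. Intervals with the
  point as right end serve both aims: shrinking one removes a piece lying wholly to its left, the
  configuration that TP2 compares, and compact sets can be covered by disjoint ones. A pointwise
  limit of distribution functions may lose mass or right continuity. If
  \<open>S_se a < S_nw a\<close>, some \<open>y\<close> has mass above it on
  \<open>X \<le> a\<close> and below it on \<open>X \<ge> a\<close>; TP2 against these two pieces
  yields the multiple of \<open>Q\<close>, and the domination excludes such losses. The bound
  \<open>S_nw x\<close> holds for the limit law at \<open>a\<close>, whose left neighbourhoods lie
  in \<open>X \<le> x\<close>. The bound \<open>S_se x\<close> can fail, since these neighbourhoods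
  may see values of \<open>Y\<close> excluded on \<open>X \<ge> x\<close>; hence the conditioning.
  Both ends of the window increase with \<open>x\<close>, so truncation preserves TP2.\<close>

definition left_nbhd :: "nat \<Rightarrow> real \<Rightarrow> real set" where
  "left_nbhd n x = {x - 1 / real (Suc n) <.. x}"

lemma left_nbhd_sets [measurable, simp]: "left_nbhd n x \<in> sets borel"
  by (simp add: left_nbhd_def)

lemma mem_left_nbhd [simp]: "x \<in> left_nbhd n x"
  by (simp add: left_nbhd_def)

lemma left_nbhd_antimono: "m \<le> n \<Longrightarrow> left_nbhd n x \<subseteq> left_nbhd m x"
proof -
  assume "m \<le> n"
  then have "1 / real (Suc n) \<le> 1 / real (Suc m)" by (intro divide_left_mono) auto
  then show ?thesis by (auto simp: left_nbhd_def)
qed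

lemma eventually_left_nbhd_gt:
  assumes "a < x"
  shows "eventually (\<lambda>n. \<forall>z\<in>left_nbhd n x. a < z) sequentially"
proof -
  obtain N where N: "1 / real (Suc N) < x - a" using assms nat_approx_posE[of "x - a"] by auto
  then have "\<forall>z\<in>left_nbhd N x. a < z" by (auto simp: left_nbhd_def)
  then show ?thesis
    unfolding eventually_sequentially using left_nbhd_antimono[of N _ x] by blast
qed

text \<open>Covers \<open>K\<close> from the top downwards: the largest point of \<open>K\<close> owns an interval, and what \<open>K\<close> has below it
  is again compact.\<close>

lemma measure_compact_le_greedy:
  fixes \<alpha> \<beta> :: "real measure"
  assumes "finite_measure \<alpha>" "finite_measure \<beta>"
    and [measurable_cong, simp]: "sets \<alpha> = sets borel" "sets \<beta> = sets borel"
    and [measurable]: "V \<in> sets borel" and e: "0 < e"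
  shows "compact K \<Longrightarrow> K \<subseteq> {l<..l + real j * e} \<Longrightarrow> K \<subseteq> {..b} \<Longrightarrow>
    (\<And>y. y \<in> K \<Longrightarrow> {y - e<..y} \<subseteq> V \<and> measure \<alpha> {y - e<..y} \<le> measure \<beta> {y - e<..y}) \<Longrightarrow>
    measure \<alpha> K \<le> measure \<beta> (V \<inter> {..b})"
proof (induction j arbitrary: K b)
  case 0
  then show ?case by simp
next
  case (Suc j)
  interpret a: finite_measure \<alpha> by fact
  interpret b: finite_measure \<beta> by fact
  show ?case
  proof (cases "K = {}")
    case False
    obtain t where t: "t \<in> K" "\<And>y. y \<in> K \<Longrightarrow> y \<le> t"
      using compact_attains_sup[OF Suc.prems(1) False] by blast
    have [measurable]: "K \<in> sets borel" using Suc.prems(1) by (simp add: borel_compact)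
    define K' where "K' = K \<inter> {..t - e}"
    have K': "compact K'" unfolding K'_def using Suc.prems(1) by (simp add: compact_Int_closed)
    have [measurable]: "K' \<in> sets borel" using K' by (simp add: borel_compact)
    \<comment> \<open>The counter \<open>j\<close> bounds the number of intervals still to be
      chosen: cutting at \<open>t - e\<close> lowers the top by at least \<open>e\<close>.\<close>
    have "t \<le> l + real (Suc j) * e" using t Suc.prems(2) by auto
    then have "t - e \<le> l + real j * e" by (simp add: algebra_simps)
    then have "measure \<alpha> K' \<le> measure \<beta> (V \<inter> {..t - e})"
      using Suc.prems by (intro Suc.IH[OF K']) (force simp: K'_def)+
    moreover have "measure \<alpha> K \<le> measure \<alpha> (K' \<union> {t - e<..t})"
      using t by (intro a.finite_measure_mono) (auto simp: K'_def)
    moreover have "measure \<alpha> (K' \<union> {t - e<..t}) \<le> measure \<alpha> K' + measure \<alpha> {t - e<..t}"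
      by (intro measure_Un_le) auto
    moreover have "measure \<alpha> {t - e<..t} \<le> measure \<beta> {t - e<..t}" using Suc.prems(4)[OF t(1)] by simp
    \<comment> \<open>The cut at \<open>t - e\<close> keeps the recursive part and the top interval
      disjoint, so the masses on the \<beta> side add up exactly, while a union bound suffices on
      the \<alpha> side.\<close>
    moreover have "measure \<beta> (V \<inter> {..t - e}) + measure \<beta> {t - e<..t}
        = measure \<beta> ((V \<inter> {..t - e}) \<union> {t - e<..t})"
      by (intro b.finite_measure_Union[symmetric]) auto
    moreover have "\<dots> \<le> measure \<beta> (V \<inter> {..b})"
    proof (intro b.finite_measure_mono)
      show "V \<inter> {..t - e} \<union> {t - e<..t} \<subseteq> V \<inter> {..b}"
        using Suc.prems(3,4) t(1) e by fastforce
    qed auto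
    ultimately show ?thesis by linarith
  qed simp
qed

text \<open>The chosen intervals stick out of \<open>K\<close>, so the greedy bound leaves a margin.
  They stay inside the closed neighbourhoods \<open>V n\<close>, which decrease to \<open>K\<close>,
  and continuity of \<beta> from above removes the margin.\<close>

lemma measure_compact_le:
  fixes \<alpha> \<beta> :: "real measure"
  assumes fin: "finite_measure \<alpha>" "finite_measure \<beta>"
    and [measurable_cong, simp]: "sets \<alpha> = sets borel" "sets \<beta> = sets borel"
    and K: "compact K"
    and le: "\<And>y n. y \<in> K \<Longrightarrow> N \<le> n \<Longrightarrow> measure \<alpha> (left_nbhd n y) \<le> measure \<beta> (left_nbhd n y)"
  shows "measure \<alpha> K \<le> measure \<beta> K"
proof (cases "K = {}")
  case False
  interpret a: finite_measure \<alpha> by fact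
  interpret b: finite_measure \<beta> by fact
  define V where "V n = {z. infdist z K \<le> 1 / real (Suc n)}" for n
  have clV: "closed (V n)" for n
    unfolding V_def by (intro closed_Collect_le continuous_intros)
  then have [measurable]: "V n \<in> sets borel" for n by simp
  have "bounded K" using K by (simp add: compact_imp_bounded)
  then obtain B where B: "\<And>x. x \<in> K \<Longrightarrow> \<bar>x\<bar> \<le> B" using bounded_real by auto
  have *: "measure \<alpha> K \<le> measure \<beta> (V n)" if "N \<le> n" for n
  proof -
    define e where "e = 1 / real (Suc n)"
    have e: "e > 0" by (simp add: e_def)
    obtain j :: nat where j: "real j > (2 * B + 1) / e" using reals_Archimedean2 by blast
    then have "2 * B + 1 < real j * e" using e by (simp add: field_simps)
    \<comment> \<open>The lower bound \<open>-B\<close> is decreased by one because the interval is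
      open at its left end.\<close>
    then have "K \<subseteq> {-B - 1<..(-B - 1) + real j * e}" using B by fastforce
    moreover have "{y - e<..y} \<subseteq> V n" if "y \<in> K" for y
    proof
      fix z assume "z \<in> {y - e<..y}"
      moreover have "infdist z K \<le> dist z y" using that by (rule infdist_le)
      ultimately show "z \<in> V n" by (auto simp: V_def e_def dist_real_def)
    qed
    ultimately have "measure \<alpha> K \<le> measure \<beta> (V n \<inter> {..B})"
      using le[OF _ \<open>N \<le> n\<close>] B
      by (intro measure_compact_le_greedy[OF fin _ _ _ e K, of _ "-B - 1" j B])
         (force simp: left_nbhd_def e_def)+
    also have "\<dots> \<le> measure \<beta> (V n)" by (intro b.finite_measure_mono) auto
    finally show ?thesis .
  qed
  have "(\<lambda>n. measure \<beta> (V n)) \<longlonglongrightarrow> measure \<beta> (\<Inter>n. V n)"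
  proof (intro b.finite_Lim_measure_decseq)
    show "decseq V"
    proof (rule decseq_SucI)
      fix n
      have "1 / real (Suc (Suc n)) \<le> 1 / real (Suc n)" by (intro divide_left_mono) auto
      then show "V (Suc n) \<subseteq> V n" by (auto simp: V_def)
    qed
  qed auto
  moreover have "(\<Inter>n. V n) = K"
  proof
    show "(\<Inter>n. V n) \<subseteq> K"
    proof
      fix z assume z: "z \<in> (\<Inter>n. V n)"
      have "infdist z K \<le> 0"
      proof (rule ccontr)
        assume "\<not> infdist z K \<le> 0"
        then obtain n where "1 / real (Suc n) < infdist z K" using nat_approx_posE[of "infdist z K"] by auto
        then show False using z by (auto simp: V_def not_le dest!: spec[of _ n])
      qed
      then have "infdist z K = 0" using infdist_nonneg[of z K] by linarith
      then show "z \<in> K" using K False by (simp add: in_closed_iff_infdist_zero compact_imp_closed)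
    qed
  qed (auto simp: V_def)
  ultimately have "(\<lambda>n. measure \<beta> (V n)) \<longlonglongrightarrow> measure \<beta> K" by simp
  then show ?thesis using * by (intro LIMSEQ_le_const) auto
qed simp

lemma measurable_measure_left_nbhd [measurable]:
  fixes \<alpha> :: "real measure"
  assumes "finite_measure \<alpha>" and [measurable_cong, simp]: "sets \<alpha> = sets borel"
  shows "(\<lambda>y. measure \<alpha> (left_nbhd n y)) \<in> borel_measurable borel"
proof -
  interpret a: finite_measure \<alpha> by fact
  have "mono (\<lambda>y. measure \<alpha> {..y})"
    by (intro monoI a.finite_measure_mono) auto
  then have [measurable]: "(\<lambda>y. measure \<alpha> {..y}) \<in> borel_measurable borel"
    by (rule borel_measurable_mono)
  have "measure \<alpha> (left_nbhd n y) = measure \<alpha> {..y} - measure \<alpha> {..y - 1 / real (Suc n)}" for y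
  proof -
    have "left_nbhd n y = {..y} - {..y - 1 / real (Suc n)}" by (auto simp: left_nbhd_def)
    then show ?thesis by (simp only:) (rule a.finite_measure_Diff; auto)
  qed
  then show ?thesis by simp
qed

text \<open>The index from which the inequality holds varies with \<open>y\<close>. The sets
  \<open>G N\<close> where it holds from \<open>N\<close> on increase to \<open>E\<close>, and inner
  regularity reduces each of them to compact subsets, on which \<open>N\<close> is uniform as the
  covering argument requires.\<close>

lemma measure_le_if_eventually_left_nbhd_le:
  fixes \<alpha> \<beta> :: "real measure"
  assumes fin: "finite_measure \<alpha>" "finite_measure \<beta>"
    and sets [measurable_cong, simp]: "sets \<alpha> = sets borel" "sets \<beta> = sets borel"
    and E [measurable]: "E \<in> sets borel"
    and le: "\<And>y. y \<in> E \<Longrightarrow>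
      eventually (\<lambda>n. measure \<alpha> (left_nbhd n y) \<le> measure \<beta> (left_nbhd n y)) sequentially"
  shows "measure \<alpha> E \<le> measure \<beta> E"
proof -
  interpret a: finite_measure \<alpha> by fact
  interpret b: finite_measure \<beta> by fact
  note [measurable] = measurable_measure_left_nbhd[OF fin(1) sets(1)] measurable_measure_left_nbhd[OF fin(2) sets(2)]
  define G where "G N = {y \<in> E. \<forall>n\<ge>N. measure \<alpha> (left_nbhd n y) \<le> measure \<beta> (left_nbhd n y)}" for N
  have [measurable]: "G N \<in> sets borel" for N
    unfolding G_def by measurable
  have *: "emeasure \<alpha> (G N) \<le> ennreal (measure \<beta> E)" for N
  proof -
    have "emeasure \<alpha> (G N) = (SUP K\<in>{K. K \<subseteq> G N \<and> compact K}. emeasure \<alpha> K)"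
      using a.emeasure_finite by (intro inner_regular) (auto simp: sets)
    also have "\<dots> \<le> ennreal (measure \<beta> E)"
    proof (intro SUP_least)
      fix K assume "K \<in> {K. K \<subseteq> G N \<and> compact K}"
      then have K: "K \<subseteq> G N" "compact K" by auto
      have "measure \<alpha> K \<le> measure \<beta> K"
        using K by (intro measure_compact_le[OF fin sets K(2), of N]) (auto simp: G_def)
      also have "\<dots> \<le> measure \<beta> E"
        using K by (intro b.finite_measure_mono) (auto simp: G_def)
      finally show "emeasure \<alpha> K \<le> ennreal (measure \<beta> E)"
        by (simp add: a.emeasure_eq_measure ennreal_leI)
    qed
    finally show ?thesis .
  qed
  have "(\<lambda>N. measure \<alpha> (G N)) \<longlonglongrightarrow> measure \<alpha> (\<Union>N. G N)"
    by (intro a.finite_Lim_measure_incseq) (auto simp: incseq_def G_def)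
  moreover have "(\<Union>N. G N) = E" using le by (auto simp: G_def eventually_sequentially)
  moreover have "measure \<alpha> (G N) \<le> measure \<beta> E" for N
    using * by (simp add: a.emeasure_eq_measure)
  ultimately show ?thesis by (intro LIMSEQ_le_const2) auto
qed

lemma scaled_measure_le_if_eventually_left_nbhd_le:
  fixes \<alpha> \<beta> :: "real measure"
  assumes fin: "finite_measure \<alpha>" "finite_measure \<beta>"
    and sets: "sets \<alpha> = sets borel" "sets \<beta> = sets borel"
    and E: "E \<in> sets borel" and st: "0 \<le> s" "0 \<le> t"
    and le: "\<And>y. y \<in> E \<Longrightarrow>
      eventually (\<lambda>n. s * measure \<alpha> (left_nbhd n y) \<le> t * measure \<beta> (left_nbhd n y)) sequentially"
  shows "s * measure \<alpha> E \<le> t * measure \<beta> E"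
proof -
  have fin': "finite_measure (scale_measure (ennreal r) \<gamma>)" if "finite_measure \<gamma>" for r \<gamma>
    using finite_measure.emeasure_finite[OF that]
    by (intro finite_measureI) (simp add: space_scale_measure ennreal_mult_eq_top_iff)
  have "measure (scale_measure (ennreal s) \<alpha>) E \<le> measure (scale_measure (ennreal t) \<beta>) E"
    by (intro measure_le_if_eventually_left_nbhd_le fin' fin) (use sets E st le in simp_all)
  then show ?thesis using st by simp
qed

text \<open>Neighbourhoods of measure zero contribute the ratio \<open>0 / 0 = 0\<close>.\<close>

lemma density_eq_if_left_nbhd_ratio_tendsto:
  fixes \<mu> \<nu> :: "real measure" and f :: "real \<Rightarrow> real"
  assumes fin: "finite_measure \<mu>" "finite_measure \<nu>"
    and sets: "sets \<mu> = sets borel" "sets \<nu> = sets borel"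
    and C: "0 \<le> C" "\<And>n y. measure \<nu> (left_nbhd n y) \<le> C * measure \<mu> (left_nbhd n y)"
    and lim: "\<And>y. (\<lambda>n. measure \<nu> (left_nbhd n y) / measure \<mu> (left_nbhd n y)) \<longlonglongrightarrow> f y"
  shows "f \<in> borel_measurable borel" "\<And>y. 0 \<le> f y" "\<And>y. f y \<le> C" "\<nu> = density \<mu> (\<lambda>y. ennreal (f y))"
proof -
  interpret m: finite_measure \<mu> by fact
  interpret n: finite_measure \<nu> by fact
  note [measurable_cong, simp] = sets
  note [measurable] = measurable_measure_left_nbhd[OF fin(1) sets(1)] measurable_measure_left_nbhd[OF fin(2) sets(2)]
  show f [measurable]: "f \<in> borel_measurable borel"
    by (rule borel_measurable_LIMSEQ_real[OF lim]) measurable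
  show f0: "0 \<le> f y" for y
    by (rule LIMSEQ_le_const[OF lim]) auto
  show fC: "f y \<le> C" for y
  proof (rule LIMSEQ_le_const2[OF lim], intro exI allI impI)
    fix n
    show "measure \<nu> (left_nbhd n y) / measure \<mu> (left_nbhd n y) \<le> C"
      using C(2)[of n y] C(1) measure_nonneg[of \<mu> "left_nbhd n y"]
      by (cases "measure \<mu> (left_nbhd n y) = 0") (auto simp: divide_le_eq less_le)
  qed
  have upper: "measure \<nu> E \<le> q * measure \<mu> E"
    if "E \<in> sets borel" "0 \<le> q" "\<And>y. y \<in> E \<Longrightarrow> f y < q" for E q
  proof -
    have "1 * measure \<nu> E \<le> q * measure \<mu> E"
    proof (intro scaled_measure_le_if_eventually_left_nbhd_le fin sets that)
      fix y assume "y \<in> E"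
      from order_tendstoD(2)[OF lim that(3)[OF this]]
      show "\<forall>\<^sub>F n in sequentially. 1 * measure \<nu> (left_nbhd n y) \<le> q * measure \<mu> (left_nbhd n y)"
      proof eventually_elim
        case (elim n)
        \<comment> \<open>On a \<mu>-null neighbourhood the ratio carries no information; the bound
          with \<open>C\<close> makes it \<nu>-null as well.\<close>
        then show ?case using C(2)[of n y] measure_nonneg[of \<mu> "left_nbhd n y"]
          by (cases "measure \<mu> (left_nbhd n y) = 0") (auto simp: divide_less_eq zero_less_measure_iff)
      qed
    qed simp
    then show ?thesis by simp
  qed
  have lower: "q * measure \<mu> E \<le> measure \<nu> E"
    if "E \<in> sets borel" "0 \<le> q" "\<And>y. y \<in> E \<Longrightarrow> q < f y" for E q
  proof -
    have "q * measure \<mu> E \<le> 1 * measure \<nu> E"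
    proof (intro scaled_measure_le_if_eventually_left_nbhd_le fin sets that)
      fix y assume "y \<in> E"
      from order_tendstoD(1)[OF lim that(3)[OF this]]
      show "\<forall>\<^sub>F n in sequentially. q * measure \<mu> (left_nbhd n y) \<le> 1 * measure \<nu> (left_nbhd n y)"
      proof eventually_elim
        case (elim n)
        then show ?case using measure_nonneg[of \<mu> "left_nbhd n y"]
          by (cases "measure \<mu> (left_nbhd n y) = 0") (auto simp: less_divide_eq zero_less_measure_iff)
      qed
    qed simp
    then show ?thesis by simp
  qed
  have "absolutely_continuous \<mu> \<nu>"
    unfolding absolutely_continuous_def
  proof
    fix E assume E: "E \<in> null_sets \<mu>"
    \<comment> \<open>\<open>C + 1\<close> instead of \<open>C\<close>, because \<open>upper\<close>
      asks for a strict bound on \<open>f\<close>, which may attain \<open>C\<close>.\<close>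
    then have "measure \<nu> E \<le> (C + 1) * measure \<mu> E"
      using C(1) by (intro upper) (auto simp: null_sets_def intro: le_less_trans[OF fC])
    also have "measure \<mu> E = 0" using E by (simp add: measure_eq_0_null_sets)
    finally show "E \<in> null_sets \<nu>"
      using E by (simp add: null_sets_def n.emeasure_eq_measure measure_le_0_iff)
  qed
  then obtain g where g [measurable]: "g \<in> borel_measurable \<mu>" and gn: "density \<mu> g = \<nu>"
    using m.Radon_Nikodym[of \<nu>] by auto
  have [measurable]: "g \<in> borel_measurable borel" using g by simp
  have nu: "ennreal (measure \<nu> E) = (\<integral>\<^sup>+y. g y * indicator E y \<partial>\<mu>)" if "E \<in> sets borel" for E
    using that by (subst n.emeasure_eq_measure[symmetric], subst gn[symmetric]) (simp add: emeasure_density)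
  have null: "AE y in \<mu>. y \<notin> E" if "E \<in> sets borel" "q < r" "q * measure \<mu> E \<ge> r * measure \<mu> E" for E and q r :: real
  proof -
    have "(r - q) * measure \<mu> E \<le> 0" using that(3) by (simp add: algebra_simps)
    then have "measure \<mu> E = 0" using that(2) by (simp add: mult_le_0_iff measure_le_0_iff)
    then show ?thesis using that(1) by (intro AE_not_in) (simp add: null_sets_def m.emeasure_eq_measure)
  qed
  have const: "(\<integral>\<^sup>+y. ennreal q * indicator E y \<partial>\<mu>) = ennreal (q * measure \<mu> E)"
    if "E \<in> sets borel" "0 \<le> q" for E q
    using that by (simp add: nn_integral_cmult_indicator m.emeasure_eq_measure ennreal_mult)
  \<comment> \<open>The differentiation bounds are played against the Radon-Nikodym density
    \<open>g\<close>: where \<open>f < q < r < g\<close>, integrating \<open>g\<close> gives at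
    least \<open>r\<close> times the \<mu>-mass, while \<open>upper\<close> allows at most
    \<open>q\<close> times it, so the set is null. Negative \<open>q\<close> is treated apart since
    \<open>ennreal\<close> truncates it.\<close>
  have 1: "AE y in \<mu>. \<not> (f y < real_of_rat q \<and> ennreal (real_of_rat r) < g y)" if "q < r" for q r
  proof (cases "0 \<le> real_of_rat q")
    case True
    define E where "E = {y. f y < real_of_rat q \<and> ennreal (real_of_rat r) < g y}"
    have r: "0 \<le> real_of_rat r" "real_of_rat q < real_of_rat r"
      using True that by (auto simp: of_rat_less intro: order_trans less_imp_le)
    have [measurable]: "E \<in> sets borel" unfolding E_def by measurable
    have "ennreal (real_of_rat r * measure \<mu> E) = (\<integral>\<^sup>+y. ennreal (real_of_rat r) * indicator E y \<partial>\<mu>)"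
      using r by (simp add: const)
    also have "\<dots> \<le> (\<integral>\<^sup>+y. g y * indicator E y \<partial>\<mu>)"
      by (intro nn_integral_mono) (auto simp: E_def indicator_def less_imp_le)
    also have "\<dots> = ennreal (measure \<nu> E)" by (simp add: nu)
    finally have "real_of_rat r * measure \<mu> E \<le> measure \<nu> E" by simp
    also have "\<dots> \<le> real_of_rat q * measure \<mu> E" using True by (intro upper) (auto simp: E_def)
    finally have "AE y in \<mu>. y \<notin> E" using r by (intro null[of _ "real_of_rat q" "real_of_rat r"]) auto
    then show ?thesis by (simp add: E_def)
  next
    case False
    then have "\<not> f y < real_of_rat q" for y using f0[of y] by linarith
    then show ?thesis by simp
  qed
  have 2: "AE y in \<mu>. \<not> (g y < ennreal (real_of_rat q) \<and> real_of_rat r < f y)" if "q < r" for q r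
  proof (cases "0 \<le> real_of_rat q")
    case True
    define E where "E = {y. g y < ennreal (real_of_rat q) \<and> real_of_rat r < f y}"
    have r: "0 \<le> real_of_rat r" "real_of_rat q < real_of_rat r"
      using True that by (auto simp: of_rat_less intro: order_trans less_imp_le)
    have [measurable]: "E \<in> sets borel" unfolding E_def by measurable
    have "ennreal (measure \<nu> E) = (\<integral>\<^sup>+y. g y * indicator E y \<partial>\<mu>)" by (simp add: nu)
    also have "\<dots> \<le> (\<integral>\<^sup>+y. ennreal (real_of_rat q) * indicator E y \<partial>\<mu>)"
      by (intro nn_integral_mono) (auto simp: E_def indicator_def less_imp_le)
    also have "\<dots> = ennreal (real_of_rat q * measure \<mu> E)"
      using True by (simp add: const)
    finally have "measure \<nu> E \<le> real_of_rat q * measure \<mu> E" using True by simp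
    moreover have "real_of_rat r * measure \<mu> E \<le> measure \<nu> E" using r by (intro lower) (auto simp: E_def)
    ultimately have "AE y in \<mu>. y \<notin> E" using r by (intro null[of _ "real_of_rat q" "real_of_rat r"]) auto
    then show ?thesis by (simp add: E_def)
  next
    case False
    then show ?thesis by (simp add: not_le ennreal_neg)
  qed
  have "AE y in \<mu>. \<forall>q r. q < r \<longrightarrow> \<not> (f y < real_of_rat q \<and> ennreal (real_of_rat r) < g y)
      \<and> \<not> (g y < ennreal (real_of_rat q) \<and> real_of_rat r < f y)"
    unfolding AE_all_countable using 1 2 by (auto simp: AE_conj_iff)
  then have "AE y in \<mu>. g y = ennreal (f y)"
  proof eventually_elim
    case (elim y)
    have rats: "\<exists>q r. a < real_of_rat q \<and> q < r \<and> real_of_rat r < b" if ab: "a < b" for a b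
    proof -
      obtain q where q: "a < real_of_rat q" "real_of_rat q < b" using of_rat_dense[OF ab] by blast
      obtain r where "real_of_rat q < real_of_rat r" "real_of_rat r < b" using of_rat_dense[OF q(2)] by blast
      with q show ?thesis by (auto simp: of_rat_less)
    qed
    have "g y \<le> ennreal (f y)"
    proof (rule ccontr)
      assume "\<not> g y \<le> ennreal (f y)"
      then have "ennreal (f y) < g y" by simp
      then obtain z where z: "ennreal (f y) < z" "z < g y" using dense by blast
      then obtain b where b: "z = ennreal b" "0 \<le> b" by (cases z) auto
      then have "f y < b" using z f0 by (simp add: ennreal_less_iff)
      then obtain q r where qr: "f y < real_of_rat q" "q < r" "real_of_rat r < b" using rats by blast
      then have "ennreal (real_of_rat r) \<le> z" using b by (simp add: ennreal_leI)
      then have "ennreal (real_of_rat r) < g y" using z(2) by (rule le_less_trans)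
      then show False using elim qr by blast
    qed
    moreover have "ennreal (f y) \<le> g y"
    proof (rule ccontr)
      assume "\<not> ennreal (f y) \<le> g y"
      then have lt: "g y < ennreal (f y)" by simp
      then obtain b where b: "g y = ennreal b" "0 \<le> b" by (cases "g y") auto
      then have "b < f y" using lt by (simp add: ennreal_less_iff)
      then obtain q r where qr: "b < real_of_rat q" "q < r" "real_of_rat r < f y" using rats by blast
      then have "g y < ennreal (real_of_rat q)" using b by (simp add: ennreal_less_iff)
      then show False using elim qr by blast
    qed
    ultimately show ?case by simp
  qed
  then have "density \<mu> g = density \<mu> (\<lambda>y. ennreal (f y))" by (intro density_cong) auto
  then show "\<nu> = density \<mu> (\<lambda>y. ennreal (f y))" using gn by simp
qed

text \<open>Here \<open>(a + b) / k\<close> is a decreasing plus an increasing sequence and stays away from zero.\<close>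

lemma convergent_ratio_if_monotone_parts:
  fixes a b k :: "nat \<Rightarrow> real"
  assumes nonneg: "\<And>m. 0 \<le> a m" "\<And>m. 0 \<le> b m" "\<And>m. 0 \<le> k m"
    and k: "\<And>m. k (Suc m) \<le> k m"
    and a: "\<And>m. a (Suc m) * k m \<le> a m * k (Suc m)"
    and b: "\<And>m. b m * k (Suc m) \<le> b (Suc m) * k m"
    and C: "\<And>m. k m \<le> C * (a m + b m)"
  shows "convergent (\<lambda>m. k m / (a m + b m))"
proof (cases "\<exists>m. k m = 0")
  case True
  then obtain m where m: "k m = 0" by blast
  have "k n = 0" if "m \<le> n" for n
    using that lift_Suc_antimono_le[of k, OF k] m nonneg(3)[of n] by (metis antisym)
  then have "eventually (\<lambda>n. k n / (a n + b n) = 0) sequentially"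
    by (auto simp: eventually_sequentially)
  then show ?thesis by (rule convergentI[OF tendsto_eventually])
next
  case False
  then have pos: "0 < k m" for m using nonneg(3)[of m] by (simp add: less_le)
  define A where "A m = a m / k m" for m
  define B where "B m = b m / k m" for m
  have ratio: "k m / (a m + b m) = inverse (A m + B m)" for m
    using pos[of m] by (simp add: A_def B_def add_divide_distrib[symmetric])
  have "1 \<le> C * (A m + B m)" for m
  proof -
    have "C * (A m + B m) = C * (a m + b m) / k m" by (simp add: A_def B_def add_divide_distrib distrib_left)
    then show ?thesis using C[of m] pos[of m] by (simp add: le_divide_eq)
  qed
  note AB = this
  have AB0: "0 \<le> A m" "0 \<le> B m" for m
    using nonneg pos[of m] by (simp_all add: A_def B_def)
  have C: "0 < C" using AB[of 0] AB0[of 0]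
    by (metis add_nonneg_nonneg less_le_trans linorder_not_less mult_nonpos_nonneg zero_less_one)
  have "decseq A"
    using a pos by (intro decseq_SucI) (simp add: A_def divide_simps mult.commute)
  then obtain LA where LA: "A \<longlonglongrightarrow> LA" using AB0 decseq_convergent by blast
  have inc: "incseq B"
    using b pos by (intro incseq_SucI) (simp add: B_def divide_simps mult.commute)
  show ?thesis
  proof (cases "\<exists>K. \<forall>m. B m \<le> K")
    case True
    then obtain LB where LB: "B \<longlonglongrightarrow> LB" using incseq_convergent[OF inc] by blast
    have "(\<lambda>m. C * (A m + B m)) \<longlonglongrightarrow> C * (LA + LB)" by (intro tendsto_intros LA LB)
    then have "1 \<le> C * (LA + LB)" using AB by (intro LIMSEQ_le_const) auto
    then have "LA + LB \<noteq> 0" by auto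
    then have "(\<lambda>m. inverse (A m + B m)) \<longlonglongrightarrow> inverse (LA + LB)" by (intro tendsto_intros LA LB)
    then show ?thesis unfolding ratio by (rule convergentI)
  next
    case False
    \<comment> \<open>With \<open>B\<close> unbounded the ratio tends to 0; for bounded
      \<open>B\<close> the bound by \<open>C\<close> was what kept the limit of the denominator away
      from 0.\<close>
    have "filterlim B at_top sequentially"
      unfolding filterlim_at_top
    proof
      fix Z
      from False obtain m where "Z < B m" by (auto simp: not_le)
      then show "\<forall>\<^sub>F n in sequentially. Z \<le> B n"
        unfolding eventually_sequentially using incseqD[OF inc, of m] by (meson less_imp_le order_trans)
    qed
    then have "filterlim (\<lambda>m. A m + B m) at_top sequentially"
      by (rule filterlim_at_top_mono) (simp add: AB0)
    then have "(\<lambda>m. inverse (A m + B m)) \<longlonglongrightarrow> 0" by (rule tendsto_inverse_0_at_top)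
    then show ?thesis unfolding ratio by (rule convergentI)
  qed
qed

text \<open>A monotone function with values in the unit interval may still fail to be right
  continuous or to have limits 0 and 1. Domination by \<open>C\<close> times \<open>Q\<close>
  squeezes \<open>F\<close> against the distribution function of \<open>Q\<close>, which has these
  properties.\<close>

lemma interval_measure_of_dominated:
  fixes Q :: "real measure" and F :: "real \<Rightarrow> real"
  assumes "real_distribution Q"
    and mono: "\<And>c d. c \<le> d \<Longrightarrow> F c \<le> F d" and bounds: "\<And>c. 0 \<le> F c" "\<And>c. F c \<le> 1"
    and dom: "\<And>c d. c \<le> d \<Longrightarrow> F d - F c \<le> C * measure Q {c<..d}"
      "\<And>c. F c \<le> C * measure Q {..c}" "\<And>c. 1 - F c \<le> C * measure Q {c<..}"
  shows "real_distribution (interval_measure F)"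
    and "measure (interval_measure F) {..c} = F c"
    and "c \<le> d \<Longrightarrow> measure (interval_measure F) {c<..d} = F d - F c"
proof -
  interpret Q: real_distribution Q by fact
  have rc: "continuous (at_right a) F" for a
    unfolding continuous_within
  proof (rule tendsto_sandwich)
    show "\<forall>\<^sub>F x in at_right a. F a \<le> F x"
      by (auto simp: eventually_at_filter intro!: always_eventually mono)
    have "F x \<le> F a + C * (cdf Q x - cdf Q a)" if "a < x" for x
    proof -
      have "cdf Q x - cdf Q a = measure Q {a<..x}" using that by (intro Q.cdf_diff_eq)
      then show ?thesis using dom(1)[of a x] that by simp
    qed
    then show "\<forall>\<^sub>F x in at_right a. F x \<le> F a + C * (cdf Q x - cdf Q a)"
      by (auto simp: eventually_at_filter intro!: always_eventually)
    have "(cdf Q \<longlongrightarrow> cdf Q a) (at_right a)"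
      using Q.cdf_is_right_cont[of a] by (simp add: continuous_within)
    then have "((\<lambda>x. F a + C * (cdf Q x - cdf Q a)) \<longlongrightarrow> F a + C * (cdf Q a - cdf Q a)) (at_right a)"
      by (intro tendsto_intros)
    then show "((\<lambda>x. F a + C * (cdf Q x - cdf Q a)) \<longlongrightarrow> F a) (at_right a)" by simp
  qed simp
  have bot: "(F \<longlongrightarrow> 0) at_bot"
  proof (rule tendsto_sandwich[of "\<lambda>_. 0" F at_bot "\<lambda>x. C * cdf Q x"])
    show "((\<lambda>x. C * cdf Q x) \<longlongrightarrow> 0) at_bot"
      using tendsto_mult[OF tendsto_const Q.cdf_lim_at_bot, of C] by simp
  qed (use bounds dom in \<open>auto simp: cdf_def intro!: always_eventually\<close>)
  have top: "(F \<longlongrightarrow> 1) at_top"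
  proof (rule tendsto_sandwich[of "\<lambda>x. 1 - C * (1 - cdf Q x)" F at_top "\<lambda>_. 1"])
    have "1 - C * (1 - cdf Q x) \<le> F x" for x
    proof -
      have "measure Q {x<..} = 1 - cdf Q x"
        using Q.prob_compl[of "{..x}"] by (simp add: cdf_def Compl_eq_Diff_UNIV[symmetric] not_le Compl_atMost)
      then show ?thesis using dom(3)[of x] by simp
    qed
    then show "\<forall>\<^sub>F x in at_top. 1 - C * (1 - cdf Q x) \<le> F x" by simp
    have "((\<lambda>x. 1 - C * (1 - cdf Q x)) \<longlongrightarrow> 1 - C * (1 - 1)) at_top"
      by (intro tendsto_intros Q.cdf_lim_at_top_prob)
    then show "((\<lambda>x. 1 - C * (1 - cdf Q x)) \<longlongrightarrow> 1) at_top" by simp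
  qed (use bounds in \<open>auto intro!: always_eventually\<close>)
  show "real_distribution (interval_measure F)"
    by (rule real_distribution_interval_measure[OF mono rc bot top])
  show "measure (interval_measure F) {..c} = F c"
    by (rule measure_interval_measure_Iic[OF mono rc bot])
  show "c \<le> d \<Longrightarrow> measure (interval_measure F) {c<..d} = F d - F c"
    by (rule measure_interval_measure_Ioc[OF _ mono rc])
qed

section \<open>Likelihood ratio order\<close>

text \<open>Returning from the cross-multiplied form to quotients leaves two degenerate cases. If
  \<open>g1 y2 = 0\<close>, the right ratio is infinite; otherwise \<open>g1 y1 = 0\<close> is
  impossible, as the inequality would bound the positive product \<open>g2 y1 * g1 y2\<close> by
  zero.\<close>

lemma lr_le_density:
  fixes Q :: "real measure" and g1 g2 :: "real \<Rightarrow> real"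
  assumes "sigma_finite_measure Q" "sets Q = sets borel"
    and [measurable]: "g1 \<in> borel_measurable borel" "g2 \<in> borel_measurable borel"
    and nonneg: "\<And>y. 0 \<le> g1 y" "\<And>y. 0 \<le> g2 y"
    and TP2: "\<And>y1 y2. y1 < y2 \<Longrightarrow> g2 y1 * g1 y2 \<le> g1 y1 * g2 y2"
  shows "lr_le (density Q (\<lambda>y. ennreal (g1 y))) (density Q (\<lambda>y. ennreal (g2 y)))"
proof -
  have "ennreal (g2 y1) / ennreal (g1 y1) \<le> ennreal (g2 y2) / ennreal (g1 y2)"
    if y: "0 < g1 y1 + g2 y1" "0 < g1 y2 + g2 y2" "y1 \<le> y2" for y1 y2
  proof (cases "y1 = y2")
    case False
    then have le: "g2 y1 * g1 y2 \<le> g1 y1 * g2 y2" using TP2 y by simp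
    show ?thesis
    proof (cases "g1 y2 = 0")
      case True
      then have "0 < g2 y2" using y by simp
      then show ?thesis using True by simp
    next
      case False
      then have pos: "0 < g1 y2" using nonneg[of y2] by simp
      have "g1 y1 \<noteq> 0"
      proof
        assume "g1 y1 = 0"
        then have "g2 y1 * g1 y2 > 0" using y pos by simp
        with le \<open>g1 y1 = 0\<close> show False by simp
      qed
      then have pos1: "0 < g1 y1" using nonneg[of y1] by simp
      have "g2 y1 / g1 y1 \<le> g2 y2 / g1 y2"
        using le pos pos1 by (simp add: divide_simps mult.commute)
      then show ?thesis using pos pos1 nonneg by (simp add: divide_ennreal ennreal_leI)
    qed
  qed simp
  then have "mono_on {y. g1 y + g2 y > 0} (\<lambda>y. ennreal (g2 y) / ennreal (g1 y))"
    by (auto intro!: mono_onI)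
  then show ?thesis
    unfolding lr_le_def using assms by blast
qed

text \<open>\<open>L\<close> is the side of \<open>s\<close> that \<open>K\<close> may charge and
  \<open>K'\<close> does not, so there \<open>K\<close> is twice the mean. Both laws may have an
  atom at \<open>s\<close>, where the quotient of the atoms gives the density; if neither has one,
  the value \<open>0 / 0 = 0\<close> sits on a null point.\<close>

lemma density_wrt_mean:
  fixes K K' \<nu> :: "real measure"
  assumes "real_distribution K" "real_distribution K'" "real_distribution \<nu>"
    and mean: "\<And>B. B \<in> sets borel \<Longrightarrow> measure \<nu> B = (measure K B + measure K' B) / 2"
    and L [measurable]: "L \<in> sets borel" and s: "s \<notin> L"
    and AE: "AE y in K. y \<in> L \<or> y = s" "AE y in K'. y \<notin> L"
  shows "K = density \<nu> (\<lambda>y. ennreal (if y \<in> L then 2 else if y = s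
    then 2 * measure K {s} / (measure K {s} + measure K' {s}) else 0))"
    (is "K = density \<nu> (\<lambda>y. ennreal (?g y))")
proof (rule measure_eqI)
  interpret K: real_distribution K by fact
  interpret K': real_distribution K' by fact
  interpret n: real_distribution \<nu> by fact
  show "sets K = sets (density \<nu> (\<lambda>y. ennreal (?g y)))" by simp
  fix B assume "B \<in> sets K"
  then have [measurable]: "B \<in> sets borel" by simp
  define p where "p = 2 * measure K {s} / (measure K {s} + measure K' {s})"
  have p: "0 \<le> p" by (simp add: p_def)
  have "emeasure (density \<nu> (\<lambda>y. ennreal (?g y))) B = (\<integral>\<^sup>+y. ennreal (?g y) * indicator B y \<partial>\<nu>)"
    by (intro emeasure_density) simp_all
  also have "\<dots> = (\<integral>\<^sup>+y. ennreal 2 * indicator (B \<inter> L) y + ennreal p * indicator (B \<inter> {s}) y \<partial>\<nu>)"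
    using s by (intro nn_integral_cong) (auto simp: indicator_def p_def)
  also have "\<dots> = ennreal (2 * measure \<nu> (B \<inter> L) + p * measure \<nu> (B \<inter> {s}))"
    using p by (simp add: nn_integral_add nn_integral_cmult_indicator n.emeasure_eq_measure
      ennreal_mult ennreal_plus del: ennreal_numeral)
  also have "measure \<nu> (B \<inter> L) = measure K (B \<inter> L) / 2"
  proof -
    have "measure K' (B \<inter> L) = 0"
      using AE(2) by (subst K'.prob_eq_0) (auto elim: eventually_mono)
    then show ?thesis by (simp add: mean)
  qed
  also have "p * measure \<nu> (B \<inter> {s}) = measure K (B \<inter> {s})"
    using measure_nonneg[of K "{s}"] measure_nonneg[of K' "{s}"]
    by (cases "s \<in> B") (auto simp: mean p_def add_nonneg_eq_0_iff)
  also have "2 * (measure K (B \<inter> L) / 2) + measure K (B \<inter> {s}) = measure K ((B \<inter> L) \<union> (B \<inter> {s}))"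
    using s by (subst K.finite_measure_Union) auto
  also have "\<dots> = measure K B"
    using AE(1) by (intro K.finite_measure_eq_AE) (auto elim: eventually_mono)
  finally show "emeasure K B = emeasure (density \<nu> (\<lambda>y. ennreal (?g y))) B"
    by (simp add: K.emeasure_eq_measure)
qed

text \<open>The dominating measure is the mean of \<open>K1\<close> and \<open>K2\<close>, realised as a coin flip.\<close>

lemma lr_le_if_separated:
  fixes K1 K2 :: "real measure"
  assumes K: "real_distribution K1" "real_distribution K2"
    and AE: "AE y in K1. y \<le> s" "AE y in K2. s \<le> y"
  shows "lr_le K1 K2"
proof -
  interpret K1: real_distribution K1 by fact
  interpret K2: real_distribution K2 by fact
  define f where "f b = (if b then K1 else K2)" for b
  define \<nu> where "\<nu> = measure_pmf (bernoulli_pmf (1/2)) \<bind> f"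
  have "f b \<in> space (prob_algebra borel)" for b
    by (simp add: f_def space_prob_algebra K1.prob_space_axioms K2.prob_space_axioms)
  then have f: "f \<in> measure_pmf (bernoulli_pmf (1/2)) \<rightarrow>\<^sub>M prob_algebra borel"
    by simp
  have "prob_space \<nu>"
    unfolding \<nu>_def using f
    by (intro measure_pmf.prob_space_bind[where S = borel] measurable_prob_algebraD)
       (auto simp: f_def K1.prob_space_axioms K2.prob_space_axioms)
  moreover have "sets \<nu> = sets borel"
    unfolding \<nu>_def by (intro sets_bind) (auto simp: f_def)
  ultimately interpret n: real_distribution \<nu>
    by (simp add: real_distribution_def real_distribution_axioms_def)
  have emeasure: "emeasure \<nu> B = (emeasure K1 B + emeasure K2 B) / 2" if "B \<in> sets borel" for B
    unfolding \<nu>_def using that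
    by (subst emeasure_bind[OF _ measurable_prob_algebraD[OF f]]) (auto simp: f_def divide_ennreal_def distrib_right)
  have mean: "measure \<nu> B = (measure K1 B + measure K2 B) / 2" if "B \<in> sets borel" for B
  proof -
    have "ennreal (measure \<nu> B) = ennreal ((measure K1 B + measure K2 B) / 2)"
      using emeasure[OF that] by (simp add: n.emeasure_eq_measure K1.emeasure_eq_measure
        K2.emeasure_eq_measure divide_ennreal[symmetric] ennreal_plus)
    then show ?thesis by simp
  qed
  define g1 where "g1 y = (if y \<in> {..<s} then 2 else if y = s
    then 2 * measure K1 {s} / (measure K1 {s} + measure K2 {s}) else 0)" for y
  define g2 where "g2 y = (if y \<in> {s<..} then 2 else if y = s
    then 2 * measure K2 {s} / (measure K2 {s} + measure K1 {s}) else 0)" for y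
  have K1: "K1 = density \<nu> (\<lambda>y. ennreal (g1 y))"
    unfolding g1_def using AE
    by (intro density_wrt_mean[OF K n.real_distribution_axioms mean]) (auto elim!: eventually_mono)
  have K2: "K2 = density \<nu> (\<lambda>y. ennreal (g2 y))"
    unfolding g2_def using AE
    by (intro density_wrt_mean[OF K(2,1) n.real_distribution_axioms]) (auto simp: mean elim!: eventually_mono)
  \<comment> \<open>For \<open>y1 < y2\<close> the product \<open>g2 y1 * g1 y2\<close> vanishes: a
    nonzero value would require \<open>s \<le> y1\<close> and \<open>y2 \<le> s\<close>.\<close>
  have "lr_le (density \<nu> (\<lambda>y. ennreal (g1 y))) (density \<nu> (\<lambda>y. ennreal (g2 y)))"
    by (intro lr_le_density n.sigma_finite_measure_axioms) (auto simp: g1_def g2_def)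
  then show ?thesis using K1 K2 by simp
qed

text \<open>Integrating the cross inequality of the densities over \<open>y \<le> c < z\<close>
  compares products of half-line masses; writing the upper tails as complements cancels the common
  product. This stochastic order will yield the measurability of the kernel.\<close>

lemma lr_le_imp_cdf_le:
  assumes "real_distribution K1" "real_distribution K2" "lr_le K1 K2"
  shows "measure K2 {..c} \<le> measure K1 {..c}"
proof -
  interpret K1: real_distribution K1 by fact
  interpret K2: real_distribution K2 by fact
  obtain \<mu> g1 g2 where sets [measurable_cong, simp]: "sets \<mu> = sets borel"
    and [measurable]: "g1 \<in> borel_measurable borel" "g2 \<in> borel_measurable borel"
    and nonneg: "\<And>y. 0 \<le> g1 y" "\<And>y. 0 \<le> g2 y"
    and K: "K1 = density \<mu> (\<lambda>y. ennreal (g1 y))" "K2 = density \<mu> (\<lambda>y. ennreal (g2 y))"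
    and mono: "mono_on {y. g1 y + g2 y > 0} (\<lambda>y. ennreal (g2 y) / ennreal (g1 y))"
    using assms(3) unfolding lr_le_def by blast
  have TP2: "g2 y1 * g1 y2 \<le> g1 y1 * g2 y2" if "y1 < y2" for y1 y2
  proof (cases "g2 y1 = 0 \<or> g1 y2 = 0")
    case True
    then show ?thesis using nonneg by auto
  next
    case False
    then have pos: "0 < g2 y1" "0 < g1 y2" using nonneg[of y1] nonneg[of y2] by auto
    have le: "ennreal (g2 y1) / ennreal (g1 y1) \<le> ennreal (g2 y2) / ennreal (g1 y2)"
      using mono_onD[OF mono, of y1 y2] pos that nonneg by (simp add: add_nonneg_pos add_pos_nonneg)
    show ?thesis
    proof (cases "g1 y1 = 0")
      case True
      \<comment> \<open>The left ratio is infinite by \<open>c / 0 = top\<close>, whereas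
        \<open>g1 y2 > 0\<close> makes the right one finite, so this case is contradictory.\<close>
      then have "ennreal (g2 y2) / ennreal (g1 y2) = top"
        using le pos by (simp add: top_unique)
      then show ?thesis using pos nonneg by (simp add: divide_ennreal)
    next
      case False
      then have "0 < g1 y1" using nonneg[of y1] by simp
      then show ?thesis using le pos nonneg
        by (simp add: divide_ennreal ennreal_le_iff divide_simps mult.commute)
    qed
  qed
  have meas: "emeasure K1 B = (\<integral>\<^sup>+y. ennreal (g1 y) * indicator B y \<partial>\<mu>)"
    "emeasure K2 B = (\<integral>\<^sup>+y. ennreal (g2 y) * indicator B y \<partial>\<mu>)" if "B \<in> sets borel" for B
    using that by (simp_all add: K emeasure_density)
  have le: "ennreal (g2 y) * emeasure K1 {c<..} \<le> ennreal (g1 y) * emeasure K2 {c<..}" if "y \<le> c" for y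
  proof -
    have "ennreal (g2 y) * emeasure K1 {c<..} = (\<integral>\<^sup>+z. ennreal (g2 y * g1 z) * indicator {c<..} z \<partial>\<mu>)"
      using nonneg by (simp add: meas nn_integral_cmult[symmetric] ennreal_mult mult.assoc)
    also have "\<dots> \<le> (\<integral>\<^sup>+z. ennreal (g1 y * g2 z) * indicator {c<..} z \<partial>\<mu>)"
      using that by (intro nn_integral_mono) (auto simp: indicator_def intro!: ennreal_leI TP2)
    also have "\<dots> = ennreal (g1 y) * emeasure K2 {c<..}"
      using nonneg by (simp add: meas nn_integral_cmult[symmetric] ennreal_mult mult.assoc)
    finally show ?thesis .
  qed
  have "emeasure K2 {..c} * emeasure K1 {c<..}
      = (\<integral>\<^sup>+y. (ennreal (g2 y) * emeasure K1 {c<..}) * indicator {..c} y \<partial>\<mu>)"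
    unfolding meas(2)[OF atMost_borel] by (subst nn_integral_multc[symmetric]) (simp_all add: ac_simps)
  also have "\<dots> \<le> (\<integral>\<^sup>+y. (ennreal (g1 y) * emeasure K2 {c<..}) * indicator {..c} y \<partial>\<mu>)"
    using le by (intro nn_integral_mono) (auto simp: indicator_def)
  also have "\<dots> = emeasure K1 {..c} * emeasure K2 {c<..}"
    unfolding meas(1)[OF atMost_borel] by (subst nn_integral_multc[symmetric]) (simp_all add: ac_simps)
  finally have "measure K2 {..c} * measure K1 {c<..} \<le> measure K1 {..c} * measure K2 {c<..}"
    by (simp add: K1.emeasure_eq_measure K2.emeasure_eq_measure ennreal_mult[symmetric])
  moreover have "measure K1 {c<..} = 1 - measure K1 {..c}" "measure K2 {c<..} = 1 - measure K2 {..c}"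
    using K1.prob_compl[of "{..c}"] K2.prob_compl[of "{..c}"]
    by (simp_all add: Compl_eq_Diff_UNIV[symmetric] Compl_atMost)
  ultimately show ?thesis by (simp add: algebra_simps)
qed

section \<open>Conditional distribution functions of a TP2 pair\<close>

text \<open>The part of \<open>left_nbhd n x\<close> outside \<open>left_nbhd (Suc n) x\<close>; it lies entirely to the left of the latter.\<close>

definition left_ring :: "nat \<Rightarrow> real \<Rightarrow> real set" where
  "left_ring n x = {x - 1 / real (Suc n) <.. x - 1 / real (Suc (Suc n))}"

lemma left_ring_sets [measurable, simp]: "left_ring n x \<in> sets borel"
  by (simp add: left_ring_def)

lemma inverse_Suc_Suc_less: "1 / real (Suc (Suc n)) < 1 / real (Suc n)"
  by (intro divide_strict_left_mono) auto

lemma left_nbhd_eq_ring_Un: "left_nbhd n x = left_ring n x \<union> left_nbhd (Suc n) x"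
proof -
  have "x - 1 / real (Suc (Suc n)) \<le> x" by simp
  then show ?thesis using inverse_Suc_Suc_less[of n]
    unfolding left_nbhd_def left_ring_def by (intro ivl_disj_un_two(6)[symmetric]) linarith+
qed

lemma left_ring_less: "set_less (left_ring n x) (left_nbhd (Suc n) x)"
  by (auto simp: set_less_def left_nbhd_def left_ring_def)

lemma set_less_disjoint: "set_less A B \<Longrightarrow> A \<inter> B = {}"
  by (auto simp: set_less_def)

section \<open>Rectangle masses of a TP2 pair\<close>

locale tp2_pair = prob_space M for M :: "'a measure" +
  fixes X Y :: "'a \<Rightarrow> real"
  assumes X [measurable]: "X \<in> borel_measurable M" and Y [measurable]: "Y \<in> borel_measurable M"
    and TP2: "TP2_distribution (joint_distr M X Y)"
begin

definition mass :: "real set \<Rightarrow> real set \<Rightarrow> real" where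
  "mass A B = \<P>(\<omega> in M. X \<omega> \<in> A \<and> Y \<omega> \<in> B)"

abbreviation "P \<equiv> distr M borel X"
abbreviation "Q \<equiv> distr M borel Y"

sublocale P: real_distribution P
  by (simp add: real_distribution_def real_distribution_axioms_def prob_space_distr)

sublocale Q: real_distribution Q
  by (simp add: real_distribution_def real_distribution_axioms_def prob_space_distr)

lemma mass_nonneg [simp]: "0 \<le> mass A B"
  by (simp add: mass_def)

lemma measure_joint_distr:
  assumes [measurable]: "A \<in> sets borel" "B \<in> sets borel"
  shows "measure (joint_distr M X Y) (A \<times> B) = mass A B"
  unfolding joint_distr_def mass_def by (subst measure_distr) (auto intro!: arg_cong[where f = prob])

lemma emeasure_joint_distr:
  assumes [measurable]: "A \<in> sets borel" "B \<in> sets borel"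
  shows "emeasure (joint_distr M X Y) (A \<times> B) = ennreal (mass A B)"
  unfolding joint_distr_def mass_def emeasure_eq_measure[symmetric]
  by (subst emeasure_distr) (auto intro!: arg_cong[where f = "emeasure M"])

lemma mass_TP2:
  assumes "A1 \<in> sets borel" "A2 \<in> sets borel" "B1 \<in> sets borel" "B2 \<in> sets borel"
    and "set_less A1 A2" "set_less B1 B2"
  shows "mass A2 B1 * mass A1 B2 \<le> mass A1 B1 * mass A2 B2"
  using TP2 assms unfolding TP2_distribution_def
  by (simp add: measure_joint_distr[symmetric])

lemma measure_P: "A \<in> sets borel \<Longrightarrow> measure P A = mass A UNIV"
  unfolding mass_def by (subst measure_distr) (auto intro!: arg_cong[where f = prob])

lemma measure_Q: "B \<in> sets borel \<Longrightarrow> measure Q B = mass UNIV B"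
  unfolding mass_def by (subst measure_distr) (auto intro!: arg_cong[where f = prob])

lemma mass_Un_left:
  assumes [measurable]: "A \<in> sets borel" "A' \<in> sets borel" "B \<in> sets borel" and "A \<inter> A' = {}"
  shows "mass (A \<union> A') B = mass A B + mass A' B"
  unfolding mass_def using assms(4)
  by (subst finite_measure_Union[symmetric]) (auto intro!: arg_cong[where f = prob])

lemma mass_Un_right:
  assumes [measurable]: "A \<in> sets borel" "B \<in> sets borel" "B' \<in> sets borel" and "B \<inter> B' = {}"
  shows "mass A (B \<union> B') = mass A B + mass A B'"
  unfolding mass_def using assms(4)
  by (subst finite_measure_Union[symmetric]) (auto intro!: arg_cong[where f = prob])

lemma mass_mono:
  assumes [measurable]: "A' \<in> sets borel" "B' \<in> sets borel" and "A \<subseteq> A'" "B \<subseteq> B'"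
  shows "mass A B \<le> mass A' B'"
  unfolding mass_def using assms(3,4) by (intro finite_measure_mono) auto

lemma mass_compl:
  assumes "A \<in> sets borel"
  shows "mass A UNIV = mass A {..c} + mass A {c<..}"
proof -
  have "{..c} \<union> {c<..} = UNIV" by auto
  moreover have "{..c} \<inter> {c<..} = {}" by auto
  ultimately show ?thesis using mass_Un_right[OF assms, of "{..c}" "{c<..}"] by simp
qed

lemma mass_Ioc:
  assumes "A \<in> sets borel" "c \<le> d"
  shows "mass A {c<..d} = mass A {..d} - mass A {..c}"
proof -
  have "{..c} \<union> {c<..d} = {..d}" using assms(2) by auto
  moreover have "{..c} \<inter> {c<..d} = {}" by auto
  ultimately show ?thesis using mass_Un_right[OF assms(1), of "{..c}" "{c<..d}"] by simp
qed

text \<open>The law of \<open>X\<close> restricted to the event that \<open>Y\<close> lies in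
  \<open>B\<close>, as a finite measure on the line. Differentiating \<open>slice {..c}\<close>
  against \<open>P\<close> is what produces the conditional distribution function at
  \<open>c\<close>.\<close>

definition slice :: "real set \<Rightarrow> real measure" where
  "slice B = distr (density M (indicator (Y -` B \<inter> space M))) borel X"

lemma sets_slice [simp, measurable_cong]: "sets (slice B) = sets borel"
  by (simp add: slice_def)

lemma emeasure_slice:
  assumes [measurable]: "A \<in> sets borel" "B \<in> sets borel"
  shows "emeasure (slice B) A = ennreal (mass A B)"
  unfolding slice_def mass_def emeasure_eq_measure[symmetric]
  by (subst emeasure_distr, simp, simp, subst emeasure_restricted)
     (auto intro!: arg_cong[where f = "emeasure M"])

lemma measure_slice: "A \<in> sets borel \<Longrightarrow> B \<in> sets borel \<Longrightarrow> measure (slice B) A = mass A B"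
  by (simp add: measure_def emeasure_slice)

lemma finite_measure_slice: "B \<in> sets borel \<Longrightarrow> finite_measure (slice B)"
  by (intro finite_measureI) (simp add: emeasure_slice slice_def[THEN arg_cong[where f = space]])

text \<open>TP2 with \<open>{..c}\<close> and \<open>{c<..}\<close>; adding the product of the two
  lower masses to both sides turns the upper half-line into the whole line. The cross-multiplied
  form remains valid when one of the sets has mass zero.\<close>

lemma mass_stochastic_mono:
  assumes [measurable]: "A1 \<in> sets borel" "A2 \<in> sets borel" and "set_less A1 A2"
  shows "mass A2 {..c} * mass A1 UNIV \<le> mass A1 {..c} * mass A2 UNIV"
proof -
  have "mass A2 {..c} * mass A1 {c<..} \<le> mass A1 {..c} * mass A2 {c<..}"
    using assms by (intro mass_TP2) (auto simp: set_less_def)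
  then show ?thesis by (simp add: mass_compl[of A1 c] mass_compl[of A2 c] algebra_simps)
qed

text \<open>The value is \<open>0\<close> as soon as the neighbourhood has mass zero, so the sequence is decreasing in all cases.\<close>

definition local_cdf :: "nat \<Rightarrow> real \<Rightarrow> real \<Rightarrow> real" where
  "local_cdf n x c = mass (left_nbhd n x) {..c} / mass (left_nbhd n x) UNIV"

definition cond_cdf :: "real \<Rightarrow> real \<Rightarrow> real" where
  "cond_cdf x c = lim (\<lambda>n. local_cdf n x c)"

lemma local_cdf_bounds: "0 \<le> local_cdf n x c" "local_cdf n x c \<le> 1"
  using mass_mono[of "left_nbhd n x" UNIV "left_nbhd n x" "{..c}"]
  by (auto simp: local_cdf_def divide_le_eq_1 less_le)

text \<open>The value at \<open>n\<close> is a weighted mean of the values of the ring and of the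
  next neighbourhood, and the ring, lying further left, has the larger value whenever both have
  positive mass.\<close>

lemma decseq_local_cdf: "decseq (\<lambda>n. local_cdf n x c)"
proof (rule decseq_SucI)
  fix n
  let ?L = "left_ring n x" and ?I = "left_nbhd (Suc n) x"
  have Un: "mass (left_nbhd n x) B = mass ?L B + mass ?I B" if "B \<in> sets borel" for B
    unfolding left_nbhd_eq_ring_Un[of n]
    using that by (intro mass_Un_left set_less_disjoint left_ring_less) auto
  show "local_cdf (Suc n) x c \<le> local_cdf n x c"
  proof (cases "mass ?I UNIV = 0")
    case True
    then show ?thesis using local_cdf_bounds(1)[of n x c] by (simp add: local_cdf_def)
  next
    case False
    then have "0 < mass ?I UNIV" by (simp add: less_le)
    moreover have "mass ?I {..c} * mass ?L UNIV \<le> mass ?L {..c} * mass ?I UNIV"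
      by (intro mass_stochastic_mono left_ring_less) auto
    moreover have "0 \<le> mass ?L UNIV" by simp
    ultimately show ?thesis
      unfolding local_cdf_def by (simp add: Un divide_simps add_pos_nonneg add_nonneg_pos) (simp add: algebra_simps add_pos_nonneg)
  qed
qed

lemma local_cdf_tendsto: "(\<lambda>n. local_cdf n x c) \<longlonglongrightarrow> cond_cdf x c"
proof -
  obtain L where "(\<lambda>n. local_cdf n x c) \<longlonglongrightarrow> L"
    using decseq_convergent[OF decseq_local_cdf] local_cdf_bounds(1) by metis
  then have "convergent (\<lambda>n. local_cdf n x c)" by (rule convergentI)
  then show ?thesis unfolding cond_cdf_def by (simp add: convergent_LIMSEQ_iff)
qed

lemma cond_cdf_bounds: "0 \<le> cond_cdf x c" "cond_cdf x c \<le> 1"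
  using LIMSEQ_le_const[OF local_cdf_tendsto] LIMSEQ_le_const2[OF local_cdf_tendsto] local_cdf_bounds
  by blast+

lemma cond_cdf_mono: "c \<le> d \<Longrightarrow> cond_cdf x c \<le> cond_cdf x d"
proof (rule LIMSEQ_le[OF local_cdf_tendsto local_cdf_tendsto], intro exI allI impI)
  fix n assume "c \<le> d"
  then show "local_cdf n x c \<le> local_cdf n x d"
    unfolding local_cdf_def by (intro divide_right_mono mass_mono) auto
qed

text \<open>The slice is dominated by \<open>P\<close> with constant 1 and the ratios converge at
  every \<open>x\<close>, so the limit is itself a density of the slice, with no choice on a null
  set involved.\<close>

lemma measurable_cond_cdf: "(\<lambda>x. cond_cdf x c) \<in> borel_measurable borel"
  and slice_eq_density: "slice {..c} = density P (\<lambda>x. ennreal (cond_cdf x c))"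
proof -
  have "measure (slice {..c}) (left_nbhd n x) \<le> 1 * measure P (left_nbhd n x)" for n x
    by (simp add: measure_slice measure_P mass_mono)
  moreover have "(\<lambda>n. measure (slice {..c}) (left_nbhd n x) / measure P (left_nbhd n x))
      \<longlonglongrightarrow> cond_cdf x c" for x
    using local_cdf_tendsto[of x c] by (simp add: measure_slice measure_P local_cdf_def)
  ultimately show "(\<lambda>x. cond_cdf x c) \<in> borel_measurable borel"
    "slice {..c} = density P (\<lambda>x. ennreal (cond_cdf x c))"
    using density_eq_if_left_nbhd_ratio_tendsto[of P "slice {..c}" 1 "\<lambda>x. cond_cdf x c"]
    by (simp_all add: finite_measure_slice P.finite_measure_axioms)
qed

lemma mass_eq_nn_integral_cond_cdf:
  assumes [measurable]: "A \<in> sets borel"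
  shows "ennreal (mass A {..c}) = (\<integral>\<^sup>+x\<in>A. ennreal (cond_cdf x c) \<partial>P)"
proof -
  note [measurable] = measurable_cond_cdf
  have "ennreal (mass A {..c}) = emeasure (slice {..c}) A" by (simp add: emeasure_slice)
  also have "\<dots> = (\<integral>\<^sup>+x\<in>A. ennreal (cond_cdf x c) \<partial>P)"
    unfolding slice_eq_density by (subst emeasure_density) auto
  finally show ?thesis .
qed

text \<open>The second clause is \<open>S_se a < S_nw a\<close> expressed by masses, with a real
  \<open>y\<close> strictly between the two; the first keeps the denominators of all local ratios
  positive.\<close>

definition two_sided :: "real \<Rightarrow> bool" where
  "two_sided a \<longleftrightarrow> (\<forall>n. 0 < mass (left_nbhd n a) UNIV) \<and>
    (\<exists>y. 0 < mass {..a} {y<..} \<and> 0 < mass {a..} {..<y})"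

lemma two_sided_pos: "two_sided a \<Longrightarrow> 0 < mass (left_nbhd n a) UNIV"
  by (simp add: two_sided_def)

text \<open>An atom at \<open>a\<close> bounds the mass of the neighbourhoods from below, which
  settles that case. Otherwise \<open>B\<close> is cut at \<open>y\<close>: TP2 compares its lower
  part with the mass above \<open>y\<close> at some distance to the left of \<open>a\<close>, and
  its upper part with the mass below \<open>y\<close> to the right of \<open>a\<close>. The constant
  is the sum of the reciprocals of these two masses.\<close>

lemma mass_left_nbhd_dominated:
  assumes a: "two_sided a"
  obtains C N where "0 \<le> C"
    "\<And>n B. N \<le> n \<Longrightarrow> B \<in> sets borel \<Longrightarrow> mass (left_nbhd n a) B \<le> C * mass (left_nbhd n a) UNIV * mass UNIV B"
proof (cases "mass {a} UNIV = 0")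
  case False
  then have pos: "0 < mass {a} UNIV" by (simp add: less_le)
  have "mass (left_nbhd n a) B \<le> (1 / mass {a} UNIV) * mass (left_nbhd n a) UNIV * mass UNIV B"
    if "B \<in> sets borel" for n B
  proof -
    have "mass {a} UNIV \<le> mass (left_nbhd n a) UNIV" by (intro mass_mono) auto
    then have "1 \<le> (1 / mass {a} UNIV) * mass (left_nbhd n a) UNIV" using pos by simp
    moreover have "mass (left_nbhd n a) B \<le> mass UNIV B" using that by (intro mass_mono) auto
    ultimately show ?thesis
      using mult_mono[of 1 "(1 / mass {a} UNIV) * mass (left_nbhd n a) UNIV" "mass (left_nbhd n a) B" "mass UNIV B"]
      by simp
  qed
  then show ?thesis using pos by (intro that[of "1 / mass {a} UNIV" 0]) auto
next
  case True
  obtain y where y: "0 < mass {..a} {y<..}" "0 < mass {a..} {..<y}" using a by (auto simp: two_sided_def)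
  have null: "mass {a} B = 0" if "B \<in> sets borel" for B
    using mass_mono[of "{a}" UNIV "{a}" B] True mass_nonneg[of "{a}" B] by simp
  \<comment> \<open>\<open>left_nbhd n a\<close> contains \<open>a\<close>, so
    \<open>set_less\<close> calls for comparison sets that avoid \<open>a\<close>; without an atom
    nothing is lost by dropping the point.\<close>
  have "{a..} = {a} \<union> {a<..}" by auto
  then have "mass {a..} {..<y} = mass {a} {..<y} + mass {a<..} {..<y}"
    by (simp only:) (intro mass_Un_left; auto)
  then have q: "0 < mass {a<..} {..<y}" using y null by simp
  \<comment> \<open>On the left the comparison set must also keep a distance from \<open>a\<close>.
    The \<open>D n\<close> exhaust \<open>{..<a}\<close>, so some \<open>D N\<close> has mass above
    \<open>y\<close>; only neighbourhoods with index at least \<open>N\<close> are sure to lie to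
    its right.\<close>
  define D where "D n = {..a - 1 / real (Suc n)}" for n
  have "(\<lambda>n. measure (slice {y<..}) (D n)) \<longlonglongrightarrow> measure (slice {y<..}) (\<Union>n. D n)"
  proof (intro finite_measure.finite_Lim_measure_incseq finite_measure_slice)
    show "incseq D"
      using inverse_Suc_Suc_less by (intro incseq_SucI) (auto simp: D_def intro: order_trans less_imp_le)
  qed (auto simp: D_def)
  moreover have "(\<Union>n. D n) = {..<a}"
  proof
    show "(\<Union>n. D n) \<subseteq> {..<a}" by (auto simp: D_def intro: le_less_trans)
    show "{..<a} \<subseteq> (\<Union>n. D n)"
    proof
      fix x assume "x \<in> {..<a}"
      then obtain n where "1 / real (Suc n) < a - x" using nat_approx_posE[of "a - x"] by auto
      then show "x \<in> (\<Union>n. D n)" by (auto simp: D_def intro!: exI[of _ n])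
    qed
  qed
  ultimately have "(\<lambda>n. mass (D n) {y<..}) \<longlonglongrightarrow> mass {..<a} {y<..}"
    by (simp add: measure_slice D_def)
  moreover have "0 < mass {..<a} {y<..}"
  proof -
    have "{..a} = {..<a} \<union> {a}" by auto
    then have "mass {..a} {y<..} = mass {..<a} {y<..} + mass {a} {y<..}"
      by (simp only:) (intro mass_Un_left; auto)
    then show ?thesis using y null by simp
  qed
  ultimately have "\<forall>\<^sub>F n in sequentially. 0 < mass (D n) {y<..}" by (rule order_tendstoD(1))
  then obtain N where p: "0 < mass (D N) {y<..}" by (auto simp: eventually_sequentially)
  have "mass (left_nbhd n a) B \<le> (1 / mass (D N) {y<..} + 1 / mass {a<..} {..<y}) * mass (left_nbhd n a) UNIV * mass UNIV B"
    if n: "N \<le> n" and [measurable]: "B \<in> sets borel" for n B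
  proof -
    let ?I = "left_nbhd n a"
    have "set_less (D N) (left_nbhd N a)" by (auto simp: set_less_def D_def left_nbhd_def)
    then have less: "set_less (D N) ?I" using left_nbhd_antimono[OF n] by (auto simp: set_less_def)
    have "mass ?I (B \<inter> {..y}) * mass (D N) {y<..} \<le> mass (D N) (B \<inter> {..y}) * mass ?I {y<..}"
      using less by (intro mass_TP2) (auto simp: D_def set_less_def)
    also have "\<dots> \<le> mass UNIV B * mass ?I UNIV"
      by (intro mult_mono mass_mono) auto
    finally have 1: "mass ?I (B \<inter> {..y}) \<le> (1 / mass (D N) {y<..}) * mass ?I UNIV * mass UNIV B"
      using p by (simp add: field_simps)
    have "mass {a<..} {..<y} * mass ?I (B \<inter> {y<..}) \<le> mass ?I {..<y} * mass {a<..} (B \<inter> {y<..})"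
      by (intro mass_TP2) (auto simp: left_nbhd_def set_less_def)
    also have "\<dots> \<le> mass ?I UNIV * mass UNIV B"
      by (intro mult_mono mass_mono) auto
    finally have 2: "mass ?I (B \<inter> {y<..}) \<le> (1 / mass {a<..} {..<y}) * mass ?I UNIV * mass UNIV B"
      using q by (simp add: field_simps)
    have "mass ?I ((B \<inter> {..y}) \<union> (B \<inter> {y<..})) = mass ?I (B \<inter> {..y}) + mass ?I (B \<inter> {y<..})"
      by (intro mass_Un_right) auto
    moreover have "(B \<inter> {..y}) \<union> (B \<inter> {y<..}) = B" by auto
    ultimately show ?thesis using 1 2 by (simp add: distrib_right)
  qed
  then show ?thesis using p q by (intro that[of "1 / mass (D N) {y<..} + 1 / mass {a<..} {..<y}" N]) auto
qed

end

section \<open>Densities of the limit laws\<close>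

context tp2_pair
begin

lemma mass_Iic_split:
  assumes "B \<in> sets borel"
  shows "mass {..a} B = mass {..a - 1 / real (Suc n)} B + mass (left_nbhd n a) B"
proof -
  have "a - 1 / real (Suc n) \<le> a" by simp
  then have "{..a - 1 / real (Suc n)} \<union> left_nbhd n a = {..a}"
    unfolding left_nbhd_def by (rule ivl_disj_un_one(3))
  moreover have "{..a - 1 / real (Suc n)} \<inter> left_nbhd n a = {}" by (auto simp: left_nbhd_def)
  ultimately show ?thesis
    using mass_Un_left[of "{..a - 1 / real (Suc n)}" "left_nbhd n a" B] assms by simp
qed

definition cond_law :: "real \<Rightarrow> real measure" where
  "cond_law a = interval_measure (cond_cdf a)"

lemma sets_cond_law [simp, measurable_cong]: "sets (cond_law a) = sets borel"
  by (simp add: cond_law_def)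

context
  fixes a :: real
  assumes a: "two_sided a"
begin

lemma local_Ioc_tendsto:
  assumes "c \<le> d"
  shows "(\<lambda>n. mass (left_nbhd n a) {c<..d} / mass (left_nbhd n a) UNIV) \<longlonglongrightarrow> cond_cdf a d - cond_cdf a c"
proof -
  have "(\<lambda>n. local_cdf n a d - local_cdf n a c) \<longlonglongrightarrow> cond_cdf a d - cond_cdf a c"
    by (intro tendsto_intros local_cdf_tendsto)
  then show ?thesis using assms by (simp add: local_cdf_def mass_Ioc diff_divide_distrib)
qed

text \<open>Only on intervals and half-lines is the convergence of the local ratios known, so only
  there does the domination pass to the limit; this suffices both to construct the law and to
  differentiate it.\<close>

lemma cond_law_dominated:
  obtains C where "0 \<le> C" "\<And>c d. c \<le> d \<Longrightarrow> cond_cdf a d - cond_cdf a c \<le> C * measure Q {c<..d}"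
    "\<And>c. cond_cdf a c \<le> C * measure Q {..c}" "\<And>c. 1 - cond_cdf a c \<le> C * measure Q {c<..}"
proof -
  obtain C N where C: "0 \<le> C" and
    dom: "\<And>n B. N \<le> n \<Longrightarrow> B \<in> sets borel \<Longrightarrow> mass (left_nbhd n a) B \<le> C * mass (left_nbhd n a) UNIV * mass UNIV B"
    using mass_left_nbhd_dominated[OF a] by metis
  have dom': "mass (left_nbhd n a) B / mass (left_nbhd n a) UNIV \<le> C * measure Q B"
    if "N \<le> n" "B \<in> sets borel" for n B
    using dom[OF that] that two_sided_pos[OF a, of n] by (simp add: measure_Q divide_le_eq ac_simps)
  show ?thesis
  proof (rule that[OF C])
    show "cond_cdf a d - cond_cdf a c \<le> C * measure Q {c<..d}" if "c \<le> d" for c d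
      by (intro LIMSEQ_le_const2[OF local_Ioc_tendsto[OF that]] exI[of _ N] allI impI dom') auto
    show "cond_cdf a c \<le> C * measure Q {..c}" for c
      by (intro LIMSEQ_le_const2[OF local_cdf_tendsto] exI[of _ N] allI impI)
         (simp add: local_cdf_def dom')
    show "1 - cond_cdf a c \<le> C * measure Q {c<..}" for c
    proof (rule LIMSEQ_le_const2)
      show "(\<lambda>n. 1 - local_cdf n a c) \<longlonglongrightarrow> 1 - cond_cdf a c"
        by (intro tendsto_intros local_cdf_tendsto)
      have "1 - local_cdf n a c = mass (left_nbhd n a) {c<..} / mass (left_nbhd n a) UNIV" for n
        using two_sided_pos[OF a, of n] mass_compl[of "left_nbhd n a" c]
        by (simp add: local_cdf_def field_simps)
      then show "\<exists>N. \<forall>n\<ge>N. 1 - local_cdf n a c \<le> C * measure Q {c<..}"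
        using dom' by (intro exI[of _ N]) simp
    qed
  qed
qed

lemma real_distribution_cond_law: "real_distribution (cond_law a)"
  and measure_cond_law_Iic: "measure (cond_law a) {..c} = cond_cdf a c"
  and measure_cond_law_Ioc: "c \<le> d \<Longrightarrow> measure (cond_law a) {c<..d} = cond_cdf a d - cond_cdf a c"
proof -
  obtain C where C: "\<And>c d. c \<le> d \<Longrightarrow> cond_cdf a d - cond_cdf a c \<le> C * measure Q {c<..d}"
    "\<And>c. cond_cdf a c \<le> C * measure Q {..c}" "\<And>c. 1 - cond_cdf a c \<le> C * measure Q {c<..}"
    using cond_law_dominated by metis
  note * = interval_measure_of_dominated[OF Q.real_distribution_axioms cond_cdf_mono cond_cdf_bounds C]
  show "real_distribution (cond_law a)" "measure (cond_law a) {..c} = cond_cdf a c"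
    "c \<le> d \<Longrightarrow> measure (cond_law a) {c<..d} = cond_cdf a d - cond_cdf a c"
    using * by (simp_all add: cond_law_def)
qed

lemma measure_cond_law_Ioc_tendsto:
  assumes "c \<le> d"
  shows "(\<lambda>n. mass (left_nbhd n a) {c<..d} / mass (left_nbhd n a) UNIV) \<longlonglongrightarrow> measure (cond_law a) {c<..d}"
  using local_Ioc_tendsto[OF assms] by (simp add: measure_cond_law_Ioc assms)

text \<open>Before the limit, TP2 compares \<open>left_nbhd n a\<close> with the half-line to its
  left; adding the product of the neighbourhood's own masses to both sides extends that half-line to
  \<open>{..a}\<close>, which no longer depends on \<open>n\<close>.\<close>

lemma cond_law_lr_lower:
  assumes "c \<le> d" "d \<le> c'" "c' \<le> d'"
  shows "measure (cond_law a) {c<..d} * mass {..a} {c'<..d'} \<le> mass {..a} {c<..d} * measure (cond_law a) {c'<..d'}"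
proof (rule LIMSEQ_le)
  let ?r = "\<lambda>n B. mass (left_nbhd n a) B / mass (left_nbhd n a) UNIV"
  show "(\<lambda>n. ?r n {c<..d} * mass {..a} {c'<..d'}) \<longlonglongrightarrow> measure (cond_law a) {c<..d} * mass {..a} {c'<..d'}"
    "(\<lambda>n. mass {..a} {c<..d} * ?r n {c'<..d'}) \<longlonglongrightarrow> mass {..a} {c<..d} * measure (cond_law a) {c'<..d'}"
    by (intro tendsto_intros measure_cond_law_Ioc_tendsto assms)+
  have "?r n {c<..d} * mass {..a} {c'<..d'} \<le> mass {..a} {c<..d} * ?r n {c'<..d'}" for n
  proof -
    let ?I = "left_nbhd n a" and ?D = "{..a - 1 / real (Suc n)}"
    have "mass ?I {c<..d} * mass ?D {c'<..d'} \<le> mass ?D {c<..d} * mass ?I {c'<..d'}"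
      using assms by (intro mass_TP2) (auto simp: set_less_def left_nbhd_def)
    then have "mass ?I {c<..d} * mass {..a} {c'<..d'} \<le> mass {..a} {c<..d} * mass ?I {c'<..d'}"
      by (simp add: mass_Iic_split[of _ a n] algebra_simps)
    then show ?thesis using two_sided_pos[OF a, of n] by (simp add: divide_right_mono)
  qed
  then show "\<exists>N. \<forall>n\<ge>N. ?r n {c<..d} * mass {..a} {c'<..d'} \<le> mass {..a} {c<..d} * ?r n {c'<..d'}" by blast
qed

text \<open>\<open>{a<..}\<close> lies to the right of every \<open>left_nbhd n a\<close>, so TP2
  applies before the limit without any completion.\<close>

lemma cond_law_lr_upper:
  assumes "c \<le> d" "d \<le> c'" "c' \<le> d'"
  shows "mass {a<..} {c<..d} * measure (cond_law a) {c'<..d'} \<le> measure (cond_law a) {c<..d} * mass {a<..} {c'<..d'}"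
proof (rule LIMSEQ_le)
  let ?r = "\<lambda>n B. mass (left_nbhd n a) B / mass (left_nbhd n a) UNIV"
  show "(\<lambda>n. mass {a<..} {c<..d} * ?r n {c'<..d'}) \<longlonglongrightarrow> mass {a<..} {c<..d} * measure (cond_law a) {c'<..d'}"
    "(\<lambda>n. ?r n {c<..d} * mass {a<..} {c'<..d'}) \<longlonglongrightarrow> measure (cond_law a) {c<..d} * mass {a<..} {c'<..d'}"
    by (intro tendsto_intros measure_cond_law_Ioc_tendsto assms)+
  have "mass {a<..} {c<..d} * ?r n {c'<..d'} \<le> ?r n {c<..d} * mass {a<..} {c'<..d'}" for n
  proof -
    let ?I = "left_nbhd n a"
    have "mass {a<..} {c<..d} * mass ?I {c'<..d'} \<le> mass ?I {c<..d} * mass {a<..} {c'<..d'}"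
      using assms by (intro mass_TP2) (auto simp: set_less_def left_nbhd_def)
    then show ?thesis using two_sided_pos[OF a, of n] by (simp add: divide_right_mono)
  qed
  then show "\<exists>N. \<forall>n\<ge>N. mass {a<..} {c<..d} * ?r n {c'<..d'} \<le> ?r n {c<..d} * mass {a<..} {c'<..d'}" by blast
qed

end

lemma cond_law_TP2:
  assumes a: "two_sided a1" "two_sided a2" "a1 < a2"
    and cd: "c \<le> d" "d \<le> c'" "c' \<le> d'"
  shows "measure (cond_law a2) {c<..d} * measure (cond_law a1) {c'<..d'}
    \<le> measure (cond_law a1) {c<..d} * measure (cond_law a2) {c'<..d'}"
proof (rule LIMSEQ_le)
  let ?r = "\<lambda>a n B. mass (left_nbhd n a) B / mass (left_nbhd n a) UNIV"
  show "(\<lambda>n. ?r a2 n {c<..d} * ?r a1 n {c'<..d'}) \<longlonglongrightarrow> measure (cond_law a2) {c<..d} * measure (cond_law a1) {c'<..d'}"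
    "(\<lambda>n. ?r a1 n {c<..d} * ?r a2 n {c'<..d'}) \<longlonglongrightarrow> measure (cond_law a1) {c<..d} * measure (cond_law a2) {c'<..d'}"
    by (intro tendsto_intros measure_cond_law_Ioc_tendsto assms)+
  \<comment> \<open>Neighbourhoods of \<open>a1\<close> and \<open>a2\<close> may overlap for small
    \<open>n\<close>; TP2 applies once \<open>left_nbhd n a2\<close> lies beyond
    \<open>a1\<close>.\<close>
  have "\<forall>\<^sub>F n in sequentially. ?r a2 n {c<..d} * ?r a1 n {c'<..d'} \<le> ?r a1 n {c<..d} * ?r a2 n {c'<..d'}"
    using eventually_left_nbhd_gt[OF a(3)]
  proof eventually_elim
    case (elim n)
    have "mass (left_nbhd n a2) {c<..d} * mass (left_nbhd n a1) {c'<..d'}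
      \<le> mass (left_nbhd n a1) {c<..d} * mass (left_nbhd n a2) {c'<..d'}"
      using cd elim by (intro mass_TP2) (auto simp: set_less_def left_nbhd_def)
    then show ?case using two_sided_pos[OF a(1), of n] two_sided_pos[OF a(2), of n]
      by (simp add: divide_right_mono ac_simps)
  qed
  then show "\<exists>N. \<forall>n\<ge>N. ?r a2 n {c<..d} * ?r a1 n {c'<..d'} \<le> ?r a1 n {c<..d} * ?r a2 n {c'<..d'}"
    by (simp add: eventually_sequentially)
qed

definition cond_density :: "real \<Rightarrow> real \<Rightarrow> real" where
  "cond_density a y = lim (\<lambda>m. measure (cond_law a) (left_nbhd m y) / measure Q (left_nbhd m y))"

lemma left_nbhd_Ioc: "left_nbhd m y = {y - 1 / real (Suc m) <.. y}" "y - 1 / real (Suc m) \<le> y"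
  by (simp_all add: left_nbhd_def)

lemma cond_density_tendsto:
  assumes a: "two_sided a"
  shows "(\<lambda>m. measure (cond_law a) (left_nbhd m y) / measure Q (left_nbhd m y)) \<longlonglongrightarrow> cond_density a y"
proof -
  let ?I = "\<lambda>m. left_nbhd m y"
  interpret K: real_distribution "cond_law a" using a by (rule real_distribution_cond_law)
  obtain C where C: "\<And>c d. c \<le> d \<Longrightarrow> cond_cdf a d - cond_cdf a c \<le> C * measure Q {c<..d}"
    using cond_law_dominated[OF a] by metis
  have "measure Q (?I m) = mass {..a} (?I m) + mass {a<..} (?I m)" for m
  proof -
    have "{..a} \<union> {a<..} = UNIV" "{..a} \<inter> {a<..} = {}" by auto
    then show ?thesis using mass_Un_left[of "{..a}" "{a<..}" "?I m"] by (simp add: measure_Q)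
  qed
  note Q_split = this
  have ring: "y - 1 / real (Suc m) \<le> y - 1 / real (Suc (Suc m))" for m
    using inverse_Suc_Suc_less[of m] by simp
  have mass_split: "mass A (?I m) = mass A (left_ring m y) + mass A (?I (Suc m))" if "A \<in> sets borel" for A m
    unfolding left_nbhd_eq_ring_Un[of m] using that
    by (intro mass_Un_right set_less_disjoint left_ring_less) auto
  have K_split: "measure (cond_law a) (?I m) = measure (cond_law a) (left_ring m y) + measure (cond_law a) (?I (Suc m))" for m
    unfolding left_nbhd_eq_ring_Un[of m]
    by (intro K.finite_measure_Union set_less_disjoint left_ring_less) auto
  have "convergent (\<lambda>m. measure (cond_law a) (?I m) / (mass {..a} (?I m) + mass {a<..} (?I m)))"
  proof (rule convergent_ratio_if_monotone_parts)
    fix m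
    show "measure (cond_law a) (?I (Suc m)) \<le> measure (cond_law a) (?I m)"
      by (intro K.finite_measure_mono left_nbhd_antimono) auto
    \<comment> \<open>The order is applied between the ring and the inner neighbourhood; adding the
      product of the two inner masses replaces the ring by the outer neighbourhood. The same device
      serves for \<open>{a<..}\<close> below.\<close>
    have "measure (cond_law a) (left_ring m y) * mass {..a} (?I (Suc m))
        \<le> mass {..a} (left_ring m y) * measure (cond_law a) (?I (Suc m))"
      unfolding left_ring_def left_nbhd_Ioc(1)
      by (intro cond_law_lr_lower[OF a] ring left_nbhd_Ioc(2)) simp
    then show "mass {..a} (?I (Suc m)) * measure (cond_law a) (?I m) \<le> mass {..a} (?I m) * measure (cond_law a) (?I (Suc m))"
      unfolding mass_split[of "{..a}" m, simplified] K_split[of m] by (simp add: algebra_simps)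
    have "mass {a<..} (left_ring m y) * measure (cond_law a) (?I (Suc m))
        \<le> measure (cond_law a) (left_ring m y) * mass {a<..} (?I (Suc m))"
      unfolding left_ring_def left_nbhd_Ioc(1)
      by (intro cond_law_lr_upper[OF a] ring left_nbhd_Ioc(2)) simp
    then show "mass {a<..} (?I m) * measure (cond_law a) (?I (Suc m)) \<le> mass {a<..} (?I (Suc m)) * measure (cond_law a) (?I m)"
      unfolding mass_split[of "{a<..}" m, simplified] K_split[of m] by (simp add: algebra_simps)
    show "measure (cond_law a) (?I m) \<le> C * (mass {..a} (?I m) + mass {a<..} (?I m))"
      unfolding Q_split[symmetric]
      unfolding left_nbhd_Ioc(1) measure_cond_law_Ioc[OF a left_nbhd_Ioc(2)]
      by (rule C[OF left_nbhd_Ioc(2)])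
  qed auto
  then show ?thesis
    unfolding cond_density_def Q_split by (simp add: convergent_LIMSEQ_iff)
qed

lemma cond_density:
  assumes a: "two_sided a"
  shows measurable_cond_density: "cond_density a \<in> borel_measurable borel"
    and cond_density_nonneg: "0 \<le> cond_density a y"
    and cond_density_bounded: "\<exists>C. \<forall>y. cond_density a y \<le> C"
    and cond_law_eq_density: "cond_law a = density Q (\<lambda>y. ennreal (cond_density a y))"
proof -
  interpret K: real_distribution "cond_law a" using a by (rule real_distribution_cond_law)
  obtain C where C: "0 \<le> C" "\<And>c d. c \<le> d \<Longrightarrow> cond_cdf a d - cond_cdf a c \<le> C * measure Q {c<..d}"
    using cond_law_dominated[OF a] by metis
  have dom: "measure (cond_law a) (left_nbhd n y) \<le> C * measure Q (left_nbhd n y)" for n y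
    unfolding left_nbhd_Ioc(1) measure_cond_law_Ioc[OF a left_nbhd_Ioc(2)]
    by (rule C(2)[OF left_nbhd_Ioc(2)])
  note * = density_eq_if_left_nbhd_ratio_tendsto[OF Q.finite_measure_axioms K.finite_measure_axioms
    _ _ C(1) dom cond_density_tendsto[OF a]]
  show "cond_density a \<in> borel_measurable borel" by (rule *(1)) auto
  show "0 \<le> cond_density a y" by (rule *(2)) auto
  show "\<exists>C. \<forall>y. cond_density a y \<le> C" by (intro exI[of _ C] allI *(3)) auto
  show "cond_law a = density Q (\<lambda>y. ennreal (cond_density a y))" by (rule *(4)) auto
qed

lemma cond_density_TP2:
  assumes a: "two_sided a1" "two_sided a2" "a1 < a2" and y: "y1 < y2"
  shows "cond_density a2 y1 * cond_density a1 y2 \<le> cond_density a1 y1 * cond_density a2 y2"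
proof (rule LIMSEQ_le)
  let ?r = "\<lambda>a m y. measure (cond_law a) (left_nbhd m y) / measure Q (left_nbhd m y)"
  show "(\<lambda>m. ?r a2 m y1 * ?r a1 m y2) \<longlonglongrightarrow> cond_density a2 y1 * cond_density a1 y2"
    "(\<lambda>m. ?r a1 m y1 * ?r a2 m y2) \<longlonglongrightarrow> cond_density a1 y1 * cond_density a2 y2"
    by (intro tendsto_intros cond_density_tendsto a)+
  have "\<forall>\<^sub>F m in sequentially. y1 \<le> y2 - 1 / real (Suc m)"
  proof -
    obtain N where N: "1 / real (Suc N) < y2 - y1" using y nat_approx_posE[of "y2 - y1"] by auto
    have "1 / real (Suc m) \<le> 1 / real (Suc N)" if "N \<le> m" for m
      using that by (intro divide_left_mono) auto
    then show ?thesis using N unfolding eventually_sequentially by (intro exI[of _ N]) force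
  qed
  then have "\<forall>\<^sub>F m in sequentially. ?r a2 m y1 * ?r a1 m y2 \<le> ?r a1 m y1 * ?r a2 m y2"
  proof eventually_elim
    case (elim m)
    have "measure (cond_law a2) (left_nbhd m y1) * measure (cond_law a1) (left_nbhd m y2)
        \<le> measure (cond_law a1) (left_nbhd m y1) * measure (cond_law a2) (left_nbhd m y2)"
      unfolding left_nbhd_Ioc(1) by (intro cond_law_TP2 a left_nbhd_Ioc(2) elim)
    then show ?case by (simp add: divide_right_mono ac_simps)
  qed
  then show "\<exists>N. \<forall>m\<ge>N. ?r a2 m y1 * ?r a1 m y2 \<le> ?r a1 m y1 * ?r a2 m y2"
    by (simp add: eventually_sequentially)
qed

end

section \<open>Boundary functions\<close>

text \<open>Turns unions of null sets \<open>X \<le> x\<close> over uncountably many \<open>x\<close> into countable ones.\<close>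

lemma countable_cofinal_subset:
  fixes D :: "real set"
  obtains C where "C \<subseteq> D" "countable C" "\<And>x. x \<in> D \<Longrightarrow> \<exists>c\<in>C. x \<le> c"
proof (cases "\<exists>m\<in>D. \<forall>x\<in>D. x \<le> m")
  case True
  then obtain m where "m \<in> D" "\<forall>x\<in>D. x \<le> m" by blast
  then show ?thesis by (intro that[of "{m}"]) auto
next
  case False
  define c where "c q = (SOME d. d \<in> D \<and> real_of_rat q < d)" for q
  define C where "C = c ` {q. \<exists>d\<in>D. real_of_rat q < d}"
  have c: "c q \<in> D \<and> real_of_rat q < c q" if "\<exists>d\<in>D. real_of_rat q < d" for q
    unfolding c_def using someI_ex[of "\<lambda>d. d \<in> D \<and> real_of_rat q < d"] that by blast
  have "\<exists>c\<in>C. x \<le> c" if "x \<in> D" for x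
  proof -
    from False that obtain d where d: "d \<in> D" "x < d" by (meson not_le)
    then obtain q where "x < real_of_rat q" "real_of_rat q < d"
      using of_rat_dense by blast
    moreover from this d have "\<exists>d\<in>D. real_of_rat q < d" by blast
    ultimately have "x \<le> c q" "c q \<in> C" unfolding C_def using c[of q] by (auto intro: less_imp_le)
    then show ?thesis by blast
  qed
  moreover have "C \<subseteq> D" using c by (auto simp: C_def)
  moreover have "countable C" by (simp add: C_def)
  ultimately show ?thesis by (intro that[of C])
qed

text \<open>Turns bounds valid on \<open>X \<le> x\<close> for each fixed \<open>x\<close>, every
  one with its own null set, into a statement about the random point \<open>X\<close>
  itself.\<close>

lemma AE_in_set_if_AE_le:
  fixes X :: "'a \<Rightarrow> real"
  assumes "\<And>x. x \<in> D \<Longrightarrow> AE \<omega> in M. X \<omega> \<le> x \<longrightarrow> \<phi> \<omega>"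
  shows "AE \<omega> in M. X \<omega> \<in> D \<longrightarrow> \<phi> \<omega>"
proof -
  obtain C where C: "C \<subseteq> D" "countable C" "\<And>x. x \<in> D \<Longrightarrow> \<exists>c\<in>C. x \<le> c"
    using countable_cofinal_subset[of D] by metis
  have "AE \<omega> in M. \<forall>c\<in>C. X \<omega> \<le> c \<longrightarrow> \<phi> \<omega>"
    using C(1) assms by (subst AE_ball_countable[OF C(2)]) blast
  then show ?thesis
  proof eventually_elim
    case (elim \<omega>)
    show ?case
    proof
      assume "X \<omega> \<in> D"
      from C(3)[OF this] obtain c where "c \<in> C" "X \<omega> \<le> c" by blast
      with elim show "\<phi> \<omega>" by blast
    qed
  qed
qed

lemma AE_in_set_if_AE_ge:
  fixes X :: "'a \<Rightarrow> real"
  assumes "\<And>x. x \<in> D \<Longrightarrow> AE \<omega> in M. x \<le> X \<omega> \<longrightarrow> \<phi> \<omega>"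
  shows "AE \<omega> in M. X \<omega> \<in> D \<longrightarrow> \<phi> \<omega>"
proof -
  have "AE \<omega> in M. - X \<omega> \<in> uminus ` D \<longrightarrow> \<phi> \<omega>"
  proof (rule AE_in_set_if_AE_le)
    fix x assume "x \<in> uminus ` D"
    then have "AE \<omega> in M. - x \<le> X \<omega> \<longrightarrow> \<phi> \<omega>" using assms by auto
    then show "AE \<omega> in M. - X \<omega> \<le> x \<longrightarrow> \<phi> \<omega>"
      by (simp add: minus_le_iff)
  qed
  then show ?thesis by (simp add: inj_image_mem_iff)
qed

text \<open>The indicator of a set closed upwards is monotone, hence measurable. Level sets of the
  isotonic boundary functions are of this kind.\<close>

lemma upset_borel:
  fixes A :: "real set"
  assumes "\<And>x y. x \<in> A \<Longrightarrow> x \<le> y \<Longrightarrow> y \<in> A"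
  shows "A \<in> sets borel"
proof -
  have "mono (indicator A :: real \<Rightarrow> real)"
    using assms by (intro monoI) (auto simp: indicator_def)
  then have "(indicator A :: real \<Rightarrow> real) \<in> borel_measurable borel" by (rule borel_measurable_mono)
  then show ?thesis by (simp add: borel_measurable_indicator_iff)
qed

lemma downset_borel:
  fixes A :: "real set"
  assumes "\<And>x y. x \<in> A \<Longrightarrow> y \<le> x \<Longrightarrow> y \<in> A"
  shows "A \<in> sets borel"
proof -
  have "- A \<in> sets borel" using assms by (intro upset_borel) auto
  then show ?thesis using borel_comp[of "- A"] by simp
qed

context tp2_pair
begin

section \<open>Boundary functions as almost sure bounds\<close>

abbreviation "nw \<equiv> S_nw M X Y"
abbreviation "se \<equiv> S_se M X Y"
abbreviation "rng \<equiv> rv_range M X"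

lemma mass_empty [simp]: "mass {} B = 0"
  by (simp add: mass_def)

lemma AE_iff_mass_eq_0:
  assumes [measurable]: "A \<in> sets borel" "B \<in> sets borel"
  shows "mass A B = 0 \<longleftrightarrow> (AE \<omega> in M. X \<omega> \<in> A \<longrightarrow> Y \<omega> \<notin> B)"
proof -
  have "mass A B = 0 \<longleftrightarrow> (AE \<omega> in M. \<not> (X \<omega> \<in> A \<and> Y \<omega> \<in> B))"
    unfolding mass_def by (subst prob_Collect_eq_0) auto
  then show ?thesis by simp
qed

lemma rng_iff: "x \<in> rng \<longleftrightarrow> 0 < mass {..x} UNIV \<and> 0 < mass {x..} UNIV"
  by (simp add: rv_range_def mass_def)

text \<open>These two facts say that the minimum is attained, and \<open>nw\<close> is handled only
  through them afterwards. Every rational above the infimum of the almost sure bounds is itself such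
  a bound; countably many null sets are discarded and density of the rationals gives the
  infimum.\<close>

lemma AE_le_nw: "AE \<omega> in M. X \<omega> \<le> x \<longrightarrow> ereal (Y \<omega>) \<le> nw x"
  and nw_least: "(AE \<omega> in M. X \<omega> \<le> x \<longrightarrow> ereal (Y \<omega>) \<le> y) \<Longrightarrow> nw x \<le> y"
proof -
  define Z where "Z y \<longleftrightarrow> (AE \<omega> in M. X \<omega> \<le> x \<longrightarrow> ereal (Y \<omega>) \<le> y)" for y
  have eq: "\<P>(\<omega> in M. X \<omega> \<le> x \<and> ereal (Y \<omega>) > y) = 0 \<longleftrightarrow> Z y" for y
    unfolding Z_def by (subst prob_Collect_eq_0) (auto simp: not_less)
  have "Z (Inf {y. Z y})"
  proof -
    have "AE \<omega> in M. \<forall>q::rat. Inf {y. Z y} < ereal (real_of_rat q) \<longrightarrow> X \<omega> \<le> x \<longrightarrow> Y \<omega> \<le> real_of_rat q"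
      unfolding AE_all_countable
    proof
      fix q :: rat
      show "AE \<omega> in M. Inf {y. Z y} < ereal (real_of_rat q) \<longrightarrow> X \<omega> \<le> x \<longrightarrow> Y \<omega> \<le> real_of_rat q"
      proof (cases "Inf {y. Z y} < ereal (real_of_rat q)")
        case True
        then obtain y where "Z y" "y < ereal (real_of_rat q)" by (auto simp: Inf_less_iff)
        from this(1) show ?thesis
          unfolding Z_def
        proof eventually_elim
          case (elim \<omega>)
          show ?case
          proof (intro impI)
            assume "X \<omega> \<le> x"
            with elim have "ereal (Y \<omega>) \<le> y" by simp
            also note \<open>y < ereal (real_of_rat q)\<close>
            finally show "Y \<omega> \<le> real_of_rat q" by simp
          qed
        qed
      qed simp
    qed
    then show ?thesis
      unfolding Z_def[of "Inf {y. Z y}"]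
    proof eventually_elim
      case (elim \<omega>)
      show ?case
      proof (intro impI, rule ccontr)
        assume "X \<omega> \<le> x" "\<not> ereal (Y \<omega>) \<le> Inf {y. Z y}"
        then have "Inf {y. Z y} < ereal (Y \<omega>)" by simp
        then obtain q where q: "Inf {y. Z y} < ereal (real_of_rat q)" "ereal (real_of_rat q) < ereal (Y \<omega>)"
          using ereal_dense3 by blast
        then show False using elim \<open>X \<omega> \<le> x\<close> by force
      qed
    qed
  qed
  then have "(LEAST y. Z y) = Inf {y. Z y}" by (intro Least_equality) (auto intro: Inf_lower)
  then have nw: "nw x = Inf {y. Z y}" by (simp add: S_nw_def eq)
  show "AE \<omega> in M. X \<omega> \<le> x \<longrightarrow> ereal (Y \<omega>) \<le> nw x"
    using \<open>Z (Inf {y. Z y})\<close> by (simp add: nw Z_def)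
  show "(AE \<omega> in M. X \<omega> \<le> x \<longrightarrow> ereal (Y \<omega>) \<le> y) \<Longrightarrow> nw x \<le> y"
    unfolding nw by (intro Inf_lower) (simp add: Z_def)
qed

lemma AE_ge_se: "AE \<omega> in M. x \<le> X \<omega> \<longrightarrow> se x \<le> ereal (Y \<omega>)"
  and se_greatest: "(AE \<omega> in M. x \<le> X \<omega> \<longrightarrow> y \<le> ereal (Y \<omega>)) \<Longrightarrow> y \<le> se x"
proof -
  define Z where "Z y \<longleftrightarrow> (AE \<omega> in M. x \<le> X \<omega> \<longrightarrow> y \<le> ereal (Y \<omega>))" for y
  have eq: "\<P>(\<omega> in M. X \<omega> \<ge> x \<and> ereal (Y \<omega>) < y) = 0 \<longleftrightarrow> Z y" for y
    unfolding Z_def by (subst prob_Collect_eq_0) (auto simp: not_less)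
  have "Z (Sup {y. Z y})"
  proof -
    have "AE \<omega> in M. \<forall>q::rat. ereal (real_of_rat q) < Sup {y. Z y} \<longrightarrow> x \<le> X \<omega> \<longrightarrow> real_of_rat q \<le> Y \<omega>"
      unfolding AE_all_countable
    proof
      fix q :: rat
      show "AE \<omega> in M. ereal (real_of_rat q) < Sup {y. Z y} \<longrightarrow> x \<le> X \<omega> \<longrightarrow> real_of_rat q \<le> Y \<omega>"
      proof (cases "ereal (real_of_rat q) < Sup {y. Z y}")
        case True
        then obtain y where "Z y" "ereal (real_of_rat q) < y" by (auto simp: less_Sup_iff)
        from this(1) show ?thesis
          unfolding Z_def
        proof eventually_elim
          case (elim \<omega>)
          show ?case
          proof (intro impI)
            assume "x \<le> X \<omega>"
            note \<open>ereal (real_of_rat q) < y\<close>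
            also have "y \<le> ereal (Y \<omega>)" using elim \<open>x \<le> X \<omega>\<close> by simp
            finally show "real_of_rat q \<le> Y \<omega>" by simp
          qed
        qed
      qed simp
    qed
    then show ?thesis
      unfolding Z_def[of "Sup {y. Z y}"]
    proof eventually_elim
      case (elim \<omega>)
      show ?case
      proof (intro impI, rule ccontr)
        assume "x \<le> X \<omega>" "\<not> Sup {y. Z y} \<le> ereal (Y \<omega>)"
        then have "ereal (Y \<omega>) < Sup {y. Z y}" by simp
        then obtain q where q: "ereal (Y \<omega>) < ereal (real_of_rat q)" "ereal (real_of_rat q) < Sup {y. Z y}"
          using ereal_dense3 by blast
        then show False using elim \<open>x \<le> X \<omega>\<close> by force
      qed
    qed
  qed
  then have "(GREATEST y. Z y) = Sup {y. Z y}" by (intro Greatest_equality) (auto intro: Sup_upper)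
  then have se: "se x = Sup {y. Z y}" by (simp add: S_se_def eq)
  show "AE \<omega> in M. x \<le> X \<omega> \<longrightarrow> se x \<le> ereal (Y \<omega>)"
    using \<open>Z (Sup {y. Z y})\<close> by (simp add: se Z_def)
  show "(AE \<omega> in M. x \<le> X \<omega> \<longrightarrow> y \<le> ereal (Y \<omega>)) \<Longrightarrow> y \<le> se x"
    unfolding se by (intro Sup_upper) (simp add: Z_def)
qed

lemma nw_mono: "x \<le> x' \<Longrightarrow> nw x \<le> nw x'"
  by (rule nw_least, rule AE_mp[OF AE_le_nw[of x']]) auto

lemma se_mono: "x \<le> x' \<Longrightarrow> se x \<le> se x'"
  by (rule se_greatest, rule AE_mp[OF AE_ge_se[of x]]) auto

lemma mass_pos_if_less_nw:
  assumes "ereal y < nw x"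
  shows "0 < mass {..x} {y<..}"
proof (rule ccontr)
  assume "\<not> 0 < mass {..x} {y<..}"
  then have "mass {..x} {y<..} = 0" using mass_nonneg[of "{..x}" "{y<..}"] by linarith
  then have "AE \<omega> in M. X \<omega> \<in> {..x} \<longrightarrow> Y \<omega> \<notin> {y<..}" by (subst (asm) AE_iff_mass_eq_0) auto
  then have "nw x \<le> ereal y" by (intro nw_least) (simp add: not_less)
  with assms show False by simp
qed

lemma mass_pos_if_se_less:
  assumes "se x < ereal y"
  shows "0 < mass {x..} {..<y}"
proof (rule ccontr)
  assume "\<not> 0 < mass {x..} {..<y}"
  then have "mass {x..} {..<y} = 0" using mass_nonneg[of "{x..}" "{..<y}"] by linarith
  then have "AE \<omega> in M. X \<omega> \<in> {x..} \<longrightarrow> Y \<omega> \<notin> {..<y}" by (subst (asm) AE_iff_mass_eq_0) auto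
  then have "ereal y \<le> se x" by (intro se_greatest) (simp add: not_less)
  with assms show False by simp
qed

lemma AE_X_in_rng: "AE \<omega> in M. X \<omega> \<in> rng"
proof -
  have "AE \<omega> in M. X \<omega> \<in> {x. mass {..x} UNIV = 0} \<longrightarrow> False"
    by (rule AE_in_set_if_AE_le) (simp add: AE_iff_mass_eq_0)
  moreover have "AE \<omega> in M. X \<omega> \<in> {x. mass {x..} UNIV = 0} \<longrightarrow> False"
    by (rule AE_in_set_if_AE_ge) (simp add: AE_iff_mass_eq_0)
  ultimately show ?thesis by eventually_elim (simp add: rng_iff less_le)
qed

text \<open>The null set in \<open>AE_le_nw\<close> depends on \<open>x\<close>, so the random point
  \<open>X\<close> cannot simply be inserted. On the level set where \<open>nw\<close> is below a
  rational \<open>q\<close>, however, the bound \<open>q\<close> is the same for all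
  \<open>x\<close>, and countably many \<open>q\<close> recover \<open>nw\<close> at
  \<open>X\<close>. The bound by \<open>se\<close> is symmetric.\<close>

lemma AE_Y_between: "AE \<omega> in M. se (X \<omega>) \<le> ereal (Y \<omega>) \<and> ereal (Y \<omega>) \<le> nw (X \<omega>)"
proof -
  have "AE \<omega> in M. \<forall>q::rat. X \<omega> \<in> {x. nw x < ereal (real_of_rat q)} \<longrightarrow> ereal (Y \<omega>) \<le> ereal (real_of_rat q)"
    unfolding AE_all_countable
  proof (intro allI AE_in_set_if_AE_le)
    fix q :: rat and x
    assume "x \<in> {x. nw x < ereal (real_of_rat q)}"
    then have le: "nw x \<le> ereal (real_of_rat q)" by simp
    show "AE \<omega> in M. X \<omega> \<le> x \<longrightarrow> ereal (Y \<omega>) \<le> ereal (real_of_rat q)"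
      using AE_le_nw[of x] by eventually_elim (blast intro: order_trans[OF _ le])
  qed
  moreover have "AE \<omega> in M. \<forall>q::rat. X \<omega> \<in> {x. ereal (real_of_rat q) < se x} \<longrightarrow> ereal (real_of_rat q) \<le> ereal (Y \<omega>)"
    unfolding AE_all_countable
  proof (intro allI AE_in_set_if_AE_ge)
    fix q :: rat and x
    assume "x \<in> {x. ereal (real_of_rat q) < se x}"
    then have le: "ereal (real_of_rat q) \<le> se x" by simp
    show "AE \<omega> in M. x \<le> X \<omega> \<longrightarrow> ereal (real_of_rat q) \<le> ereal (Y \<omega>)"
      using AE_ge_se[of x] by eventually_elim (blast intro: order_trans[OF le])
  qed
  ultimately show ?thesis
  proof eventually_elim
    case (elim \<omega>)
    show ?case
    proof (intro conjI; rule ccontr)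
      assume "\<not> se (X \<omega>) \<le> ereal (Y \<omega>)"
      then have "ereal (Y \<omega>) < se (X \<omega>)" by simp
      then obtain q where "ereal (Y \<omega>) < ereal (real_of_rat q)" "ereal (real_of_rat q) < se (X \<omega>)"
        using ereal_dense3 by blast
      then show False using elim(2) by (force simp: not_le)
    next
      assume "\<not> ereal (Y \<omega>) \<le> nw (X \<omega>)"
      then have "nw (X \<omega>) < ereal (Y \<omega>)" by simp
      then obtain q where "nw (X \<omega>) < ereal (real_of_rat q)" "ereal (real_of_rat q) < ereal (Y \<omega>)"
        using ereal_dense3 by blast
      then show False using elim(1) by (force simp: not_le)
    qed
  qed
qed

lemma rng_borel [measurable]: "rng \<in> sets borel"
proof -
  have "{x. 0 < mass {..x} UNIV} \<in> sets borel"
  proof (rule upset_borel)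
    fix x y assume "x \<in> {x. 0 < mass {..x} UNIV}" "x \<le> y"
    then show "y \<in> {x. 0 < mass {..x} UNIV}"
      using mass_mono[of "{..y}" UNIV "{..x}" UNIV] by simp
  qed
  moreover have "{x. 0 < mass {x..} UNIV} \<in> sets borel"
  proof (rule downset_borel)
    fix x y assume "x \<in> {x. 0 < mass {x..} UNIV}" "y \<le> x"
    then show "y \<in> {x. 0 < mass {x..} UNIV}"
      using mass_mono[of "{y..}" UNIV "{x..}" UNIV] by simp
  qed
  moreover have "rng = {x. 0 < mass {..x} UNIV} \<inter> {x. 0 < mass {x..} UNIV}"
    by (auto simp: rng_iff)
  ultimately show ?thesis by auto
qed

lemma less_se_borel [measurable]: "{x. y < se x} \<in> sets borel"
  by (intro upset_borel) (auto intro: less_le_trans se_mono)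

lemma se_less_borel [measurable]: "{x. se x < y} \<in> sets borel"
  by (intro downset_borel) (auto intro: le_less_trans se_mono)

lemma less_nw_borel [measurable]: "{x. y < nw x} \<in> sets borel"
  by (intro upset_borel) (auto intro: less_le_trans nw_mono)

text \<open>The set \<open>\<X> - \<X>\<^sub>o\<close> of the paper.\<close>

definition regular :: "real set" where
  "regular = rng - range_o M X Y"

lemma regular_iff: "x \<in> regular \<longleftrightarrow> x \<in> rng \<and> se x < nw x"
  by (auto simp: regular_def range_o_def not_le)

lemma regular_borel [measurable]: "regular \<in> sets borel"
proof -
  have "regular = rng \<inter> (\<Union>q::rat. {x. se x < ereal (real_of_rat q)} \<inter> {x. ereal (real_of_rat q) < nw x})"
    using ereal_dense3 by (fastforce simp: regular_iff)
  then show ?thesis by auto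
qed

lemma range_o_borel [measurable]: "range_o M X Y \<in> sets borel"
proof -
  have "range_o M X Y = rng - regular" by (auto simp: regular_def range_o_def)
  then show ?thesis by auto
qed

text \<open>The left end of the gap of the distribution of \<open>X\<close> around \<open>x\<close>, and \<open>x\<close> itself if there is none.\<close>

definition supp_left :: "real \<Rightarrow> real" where
  "supp_left x = Inf {x'. x' \<le> x \<and> mass {x'<..x} UNIV = 0}"

text \<open>Mass at or below \<open>x\<close> keeps the null intervals ending at \<open>x\<close>
  from reaching arbitrarily far left, so the infimum is finite. Continuity makes the whole interval
  from the infimum to \<open>x\<close> null, and minimality forces every left neighbourhood of the
  infimum to carry mass.\<close>

lemma
  assumes x: "0 < mass {..x} UNIV"
  shows supp_left_le: "supp_left x \<le> x"
    and mass_supp_left: "mass {supp_left x<..x} UNIV = 0"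
    and mass_left_nbhd_supp_left: "0 < mass (left_nbhd n (supp_left x)) UNIV"
    and supp_left_lower: "x' \<le> x \<Longrightarrow> mass {x'<..x} UNIV = 0 \<Longrightarrow> supp_left x \<le> x'"
proof -
  let ?A = "{x'. x' \<le> x \<and> mass {x'<..x} UNIV = 0}"
  have ne: "x \<in> ?A" by simp
  \<comment> \<open>Exhausting \<open>{..x}\<close> yields a \<open>k\<close> with mass in
    \<open>{- real k<..x}\<close>; then \<open>- real k\<close> is a lower bound of the set.\<close>
  have "(\<lambda>k. measure P {- real k<..x}) \<longlonglongrightarrow> measure P (\<Union>k. {- real k<..x})"
    by (intro P.finite_Lim_measure_incseq) (auto simp: incseq_def)
  moreover have "(\<Union>k. {- real k<..x}) = {..x}"
  proof -
    have "\<exists>k. - real k < z" for z using reals_Archimedean2[of "- z"] by (auto simp: minus_less_iff)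
    then show ?thesis by auto
  qed
  ultimately have "(\<lambda>k. mass {- real k<..x} UNIV) \<longlonglongrightarrow> mass {..x} UNIV" by (simp add: measure_P)
  from order_tendstoD(1)[OF this x] obtain k where k: "0 < mass {- real k<..x} UNIV"
    by (auto simp: eventually_sequentially)
  have bdd: "bdd_below ?A"
  proof (rule bdd_belowI)
    fix x' assume x': "x' \<in> ?A"
    show "- real k \<le> x'"
    proof (rule ccontr)
      assume "\<not> - real k \<le> x'"
      then have "{- real k<..x} \<subseteq> {x'<..x}" by auto
      then have "mass {- real k<..x} UNIV \<le> mass {x'<..x} UNIV" by (intro mass_mono) auto
      with k x' show False by simp
    qed
  qed
  show lower: "supp_left x \<le> x'" if "x' \<le> x" "mass {x'<..x} UNIV = 0" for x'
    unfolding supp_left_def using that by (intro cInf_lower bdd) auto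
  show le: "supp_left x \<le> x" using ne by (intro lower) auto
  have "{supp_left x + 1 / real (Suc j)<..x} \<in> null_sets P" for j
  proof -
    have "Inf ?A < supp_left x + 1 / real (Suc j)" by (simp add: supp_left_def)
    then obtain x' where x': "x' \<in> ?A" "x' < supp_left x + 1 / real (Suc j)"
      using cInf_lessD[of ?A] ne by blast
    have "mass {supp_left x + 1 / real (Suc j)<..x} UNIV \<le> mass {x'<..x} UNIV"
      using x' by (intro mass_mono) auto
    then have "mass {supp_left x + 1 / real (Suc j)<..x} UNIV = 0"
      using x' by (simp add: order_antisym)
    then show ?thesis by (simp add: null_sets_def P.emeasure_eq_measure measure_P del: emeasure_distr)
  qed
  then have "(\<Union>j. {supp_left x + 1 / real (Suc j)<..x}) \<in> null_sets P" by (rule null_sets_UN)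
  moreover have "(\<Union>j. {supp_left x + 1 / real (Suc j)<..x}) = {supp_left x<..x}"
  proof
    show "{supp_left x<..x} \<subseteq> (\<Union>j. {supp_left x + 1 / real (Suc j)<..x})"
    proof
      fix z assume z: "z \<in> {supp_left x<..x}"
      then obtain j where "1 / real (Suc j) < z - supp_left x"
        using nat_approx_posE[of "z - supp_left x"] by auto
      then show "z \<in> (\<Union>j. {supp_left x + 1 / real (Suc j)<..x})"
        using z by (auto intro!: exI[of _ j])
    qed
  next
    have "{supp_left x + 1 / real (Suc j)<..x} \<subseteq> {supp_left x<..x}" for j
    proof -
      have "supp_left x \<le> supp_left x + 1 / real (Suc j)" by simp
      then show ?thesis by (intro Ioc_subset_iff[THEN iffD2] disjI2 conjI order_refl)
    qed
    then show "(\<Union>j. {supp_left x + 1 / real (Suc j)<..x}) \<subseteq> {supp_left x<..x}" by blast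
  qed
  ultimately have "measure P {supp_left x<..x} = 0" by (simp add: measure_eq_0_null_sets)
  then show null: "mass {supp_left x<..x} UNIV = 0" by (simp add: measure_P)
  show "0 < mass (left_nbhd n (supp_left x)) UNIV"
  proof (rule ccontr)
    let ?a = "supp_left x - 1 / real (Suc n)"
    have a: "?a < supp_left x" by simp
    assume "\<not> 0 < mass (left_nbhd n (supp_left x)) UNIV"
    then have 0: "mass (left_nbhd n (supp_left x)) UNIV = 0"
      using mass_nonneg[of "left_nbhd n (supp_left x)" UNIV] by linarith
    \<comment> \<open>A null neighbourhood would prolong the gap beyond its left end.\<close>
    have "left_nbhd n (supp_left x) \<union> {supp_left x<..x} = {?a<..x}"
      using le a unfolding left_nbhd_def by (intro ivl_disj_un_two(6)) linarith+
    moreover have "left_nbhd n (supp_left x) \<inter> {supp_left x<..x} = {}" by (auto simp: left_nbhd_def)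
    ultimately have "mass {?a<..x} UNIV = 0"
      using mass_Un_left[of "left_nbhd n (supp_left x)" "{supp_left x<..x}" UNIV] 0 null by simp
    then have "supp_left x \<le> ?a" using a le by (intro lower) linarith+
    with a show False by linarith
  qed
qed

lemma supp_left_mono:
  assumes x: "0 < mass {..x1} UNIV" "x1 \<le> x2"
  shows "supp_left x1 \<le> supp_left x2"
proof (cases "supp_left x2 \<le> x1")
  case True
  have x2: "0 < mass {..x2} UNIV" using x mass_mono[of "{..x2}" UNIV "{..x1}" UNIV] by simp
  have "mass {supp_left x2<..x1} UNIV \<le> mass {supp_left x2<..x2} UNIV"
    using x(2) by (intro mass_mono) auto
  then have "mass {supp_left x2<..x1} UNIV = 0" using mass_supp_left[OF x2] by (simp add: order_antisym)
  then show ?thesis using supp_left_lower[OF x(1) True] by simp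
next
  case False
  then show ?thesis using supp_left_le[OF x(1)] by linarith
qed

text \<open>The gap is null, so \<open>X \<le> x\<close> and \<open>X \<le> supp_left x\<close>
  agree almost surely. This transfers the mass that \<open>nw x\<close> guarantees above a level to
  the left end of the gap.\<close>

lemma mass_Iic_supp_left:
  assumes x: "0 < mass {..x} UNIV" and B: "B \<in> sets borel"
  shows "mass {..supp_left x} B = mass {..x} B"
proof -
  have "{..supp_left x} \<union> {supp_left x<..x} = {..x}" using supp_left_le[OF x] by auto
  moreover have "mass {supp_left x<..x} B \<le> 0"
    using mass_mono[of "{supp_left x<..x}" UNIV "{supp_left x<..x}" B] by (simp add: mass_supp_left[OF x])
  then have "mass {supp_left x<..x} B = 0" by (simp add: order_antisym)
  moreover have "{..supp_left x} \<inter> {supp_left x<..x} = {}" by auto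
  ultimately show ?thesis using mass_Un_left[of "{..supp_left x}" "{supp_left x<..x}" B] B by simp
qed

lemma two_sided_supp_left:
  assumes x: "x \<in> regular"
  shows "two_sided (supp_left x)"
proof -
  have pos: "0 < mass {..x} UNIV" using x by (simp add: regular_iff rng_iff)
  obtain q where q: "se x < ereal (real_of_rat q)" "ereal (real_of_rat q) < nw x"
    using x ereal_dense3 by (auto simp: regular_iff)
  have "0 < mass {..supp_left x} {real_of_rat q<..}"
    using mass_pos_if_less_nw[OF q(2)] by (simp add: mass_Iic_supp_left[OF pos])
  moreover have "mass {x..} {..<real_of_rat q} \<le> mass {supp_left x..} {..<real_of_rat q}"
    using supp_left_le[OF pos] by (intro mass_mono) auto
  then have "0 < mass {supp_left x..} {..<real_of_rat q}"
    using mass_pos_if_se_less[OF q(1)] by linarith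
  ultimately show ?thesis
    using mass_left_nbhd_supp_left[OF pos] by (auto simp: two_sided_def)
qed

end

section \<open>The kernel\<close>

context tp2_pair
begin

definition window :: "real \<Rightarrow> real set" where
  "window x = {y. se x \<le> ereal y \<and> ereal y \<le> nw x}"

lemma window_borel [measurable]: "window x \<in> sets borel"
  unfolding window_def by measurable

text \<open>By TP2 each local law at \<open>a\<close> is stochastically at least the law of
  \<open>Y\<close> given \<open>X \<le> a\<close>, and the latter charges \<open>{y<..}\<close>; the
  strict inequality survives because this bound does not depend on \<open>n\<close>.\<close>

lemma cond_cdf_less_1:
  assumes a: "two_sided a" and y: "0 < mass {..a} {y<..}"
  shows "cond_cdf a y < 1"
proof -
  have split: "mass {..a} UNIV = mass {..a} {..y} + mass {..a} {y<..}" by (intro mass_compl) simp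
  then have pos: "0 < mass {..a} UNIV" using y mass_nonneg[of "{..a}" "{..y}"] by linarith
  have "local_cdf n a y \<le> mass {..a} {..y} / mass {..a} UNIV" for n
  proof -
    let ?I = "left_nbhd n a" and ?D = "{..a - 1 / real (Suc n)}"
    have "mass ?I {..y} * mass ?D UNIV \<le> mass ?D {..y} * mass ?I UNIV"
      by (intro mass_stochastic_mono) (auto simp: set_less_def left_nbhd_def)
    then have "mass ?I {..y} * mass {..a} UNIV \<le> mass {..a} {..y} * mass ?I UNIV"
      by (simp add: mass_Iic_split[of _ a n] algebra_simps)
    then show ?thesis using pos two_sided_pos[OF a, of n] by (simp add: local_cdf_def divide_simps mult.commute)
  qed
  then have "cond_cdf a y \<le> mass {..a} {..y} / mass {..a} UNIV"
    by (intro LIMSEQ_le_const2[OF local_cdf_tendsto]) blast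
  also have "\<dots> < 1" using split y pos by simp
  finally show ?thesis .
qed

text \<open>Every left neighbourhood of \<open>supp_left x\<close> lies in \<open>{..x}\<close>, so
  if \<open>nw x\<close> is finite all local distribution functions already equal 1 there. Of the
  infinite values, the upper one is trivial and the lower one is excluded by
  \<open>se x < nw x\<close>.\<close>

lemma AE_cond_law_le_nw:
  assumes x: "x \<in> regular"
  shows "AE y in cond_law (supp_left x). ereal y \<le> nw x"
proof (cases "nw x")
  case (real r)
  let ?a = "supp_left x"
  have pos: "0 < mass {..x} UNIV" using x by (simp add: regular_iff rng_iff)
  interpret K: real_distribution "cond_law ?a"
    by (intro real_distribution_cond_law two_sided_supp_left x)
  have 0: "mass {..x} {r<..} = 0"
    using AE_le_nw[of x] by (subst AE_iff_mass_eq_0) (simp_all add: real not_less)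
  have "local_cdf n ?a r = 1" for n
  proof -
    have "mass (left_nbhd n ?a) {r<..} \<le> mass {..x} {r<..}"
      using supp_left_le[OF pos] by (intro mass_mono) (auto simp: left_nbhd_def)
    then have "mass (left_nbhd n ?a) {r<..} = 0" using 0 by (simp add: order_antisym)
    then show ?thesis
      using mass_compl[of "left_nbhd n ?a" r] mass_left_nbhd_supp_left[OF pos, of n]
      by (simp add: local_cdf_def)
  qed
  then have "cond_cdf ?a r = 1"
    using local_cdf_tendsto[of ?a r] by (simp add: LIMSEQ_const_iff)
  then have "K.prob {..r} = 1" by (simp add: measure_cond_law_Iic[OF two_sided_supp_left[OF x]])
  then have "AE y in cond_law ?a. y \<in> {..r}" by (rule K.AE_prob_1)
  then show ?thesis by (simp add: real)
qed (use x in \<open>simp_all add: regular_iff\<close>)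

definition wt :: "real \<Rightarrow> real" where
  "wt x = measure (cond_law (supp_left x)) (window x)"

text \<open>For \<open>q\<close> strictly between \<open>se x\<close> and \<open>nw x\<close> the
  limit law charges \<open>{q<..}\<close>, and almost all of that mass is below \<open>nw x\<close>,
  hence inside the window.\<close>

lemma wt_pos:
  assumes x: "x \<in> regular"
  shows "0 < wt x"
proof -
  let ?a = "supp_left x"
  have pos: "0 < mass {..x} UNIV" using x by (simp add: regular_iff rng_iff)
  interpret K: real_distribution "cond_law ?a"
    by (intro real_distribution_cond_law two_sided_supp_left x)
  obtain q where q: "se x < ereal (real_of_rat q)" "ereal (real_of_rat q) < nw x"
    using x ereal_dense3 by (auto simp: regular_iff)
  have "cond_cdf ?a (real_of_rat q) < 1"
    using mass_pos_if_less_nw[OF q(2)]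
    by (intro cond_cdf_less_1 two_sided_supp_left x) (simp add: mass_Iic_supp_left[OF pos])
  then have "0 < 1 - K.prob {..real_of_rat q}"
    by (simp add: measure_cond_law_Iic[OF two_sided_supp_left[OF x]])
  also have "\<dots> = K.prob {real_of_rat q<..}"
    using K.prob_compl[of "{..real_of_rat q}"] by (simp add: Compl_eq_Diff_UNIV[symmetric] Compl_atMost)
  also have "\<dots> \<le> wt x"
    unfolding wt_def
  proof (intro K.finite_measure_mono_AE)
    show "AE y in cond_law ?a. y \<in> {real_of_rat q<..} \<longrightarrow> y \<in> window x"
      using AE_cond_law_le_nw[OF x]
    proof eventually_elim
      case (elim y)
      show ?case
      proof
        assume "y \<in> {real_of_rat q<..}"
        then have "ereal (real_of_rat q) \<le> ereal y" by simp
        then have "se x \<le> ereal y" using q(1) by (meson less_imp_le order_trans)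
        then show "y \<in> window x" using elim by (simp add: window_def)
      qed
    qed
  qed simp
  finally show ?thesis .
qed

definition kernel_density :: "real \<Rightarrow> real \<Rightarrow> real" where
  "kernel_density x y = cond_density (supp_left x) y * indicator (window x) y / wt x"

context
  fixes x :: real
  assumes x: "x \<in> regular"
begin

lemma measurable_kernel_density [measurable]: "kernel_density x \<in> borel_measurable borel"
proof -
  note [measurable] = measurable_cond_density[OF two_sided_supp_left[OF x]]
  show ?thesis unfolding kernel_density_def by measurable
qed

lemma kernel_density_nonneg: "0 \<le> kernel_density x y"
  using cond_density_nonneg[OF two_sided_supp_left[OF x]] wt_pos[OF x]
  by (simp add: kernel_density_def)

lemma kernel_density_bounded: "\<exists>C. \<forall>y. kernel_density x y \<le> C"
proof -
  obtain C where C: "\<And>y. cond_density (supp_left x) y \<le> C"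
    using cond_density_bounded[OF two_sided_supp_left[OF x]] by blast
  have "kernel_density x y \<le> C / wt x" for y
  proof -
    have "cond_density (supp_left x) y * indicator (window x) y \<le> cond_density (supp_left x) y"
      using cond_density_nonneg[OF two_sided_supp_left[OF x]] by (simp add: indicator_def)
    also note C
    finally show ?thesis using wt_pos[OF x] by (simp add: kernel_density_def divide_right_mono)
  qed
  then show ?thesis by blast
qed

lemma emeasure_kernel_density:
  assumes [measurable]: "B \<in> sets borel"
  shows "emeasure (density Q (\<lambda>y. ennreal (kernel_density x y))) B
    = ennreal (measure (cond_law (supp_left x)) (B \<inter> window x) / wt x)"
proof -
  let ?a = "supp_left x"
  interpret K: real_distribution "cond_law ?a"
    by (intro real_distribution_cond_law two_sided_supp_left x)
  note [measurable] = measurable_cond_density[OF two_sided_supp_left[OF x]]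
  have "emeasure (density Q (\<lambda>y. ennreal (kernel_density x y))) B
      = (\<integral>\<^sup>+y. ennreal (kernel_density x y) * indicator B y \<partial>Q)"
    by (simp add: emeasure_density)
  also have "\<dots> = (\<integral>\<^sup>+y. ennreal (1 / wt x) * (ennreal (cond_density ?a y) * indicator (B \<inter> window x) y) \<partial>Q)"
    using wt_pos[OF x] cond_density_nonneg[OF two_sided_supp_left[OF x]]
    by (intro nn_integral_cong)
       (auto simp: kernel_density_def indicator_def ennreal_mult[symmetric] simp del: ennreal_1)
  also have "\<dots> = ennreal (1 / wt x) * (\<integral>\<^sup>+y. ennreal (cond_density ?a y) * indicator (B \<inter> window x) y \<partial>Q)"
    by (intro nn_integral_cmult) simp
  also have "(\<integral>\<^sup>+y. ennreal (cond_density ?a y) * indicator (B \<inter> window x) y \<partial>Q)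
      = emeasure (density Q (\<lambda>y. ennreal (cond_density ?a y))) (B \<inter> window x)"
    by (simp add: emeasure_density)
  also have "\<dots> = emeasure (cond_law ?a) (B \<inter> window x)"
    by (simp only: cond_law_eq_density[OF two_sided_supp_left[OF x], symmetric])
  also have "ennreal (1 / wt x) * \<dots> = ennreal (measure (cond_law ?a) (B \<inter> window x) / wt x)"
    using wt_pos[OF x] by (simp add: K.emeasure_eq_measure ennreal_mult[symmetric])
  finally show ?thesis .
qed

lemma real_distribution_kernel_density:
  "real_distribution (density Q (\<lambda>y. ennreal (kernel_density x y)))"
proof -
  have "emeasure (density Q (\<lambda>y. ennreal (kernel_density x y))) UNIV = 1"
    using wt_pos[OF x] by (simp add: emeasure_kernel_density) (simp add: wt_def)
  then show ?thesis
    by (auto simp: real_distribution_def real_distribution_axioms_def intro!: prob_spaceI)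
qed

lemma kernel_density_outside: "y \<notin> window x \<Longrightarrow> kernel_density x y = 0"
  by (simp add: kernel_density_def)

lemma AE_kernel_density_window: "AE y in density Q (\<lambda>y. ennreal (kernel_density x y)). y \<in> window x"
proof (subst AE_density)
  show "(\<lambda>y. ennreal (kernel_density x y)) \<in> borel_measurable Q" by measurable
  show "AE y in Q. 0 < ennreal (kernel_density x y) \<longrightarrow> y \<in> window x"
    by (rule AE_I2) (auto simp: kernel_density_def indicator_def)
qed

end

text \<open>Both ends of the window increase with \<open>x\<close>, so if \<open>y1\<close> lies in
  the upper window and \<open>y2\<close> in the lower one, then each of the two points lies in both
  windows; otherwise the left side vanishes. The normalising constants are common to both sides.
  Points of one gap share \<open>supp_left\<close>, which makes the density products equal.\<close>

lemma kernel_density_TP2: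
  assumes x: "x1 \<in> regular" "x2 \<in> regular" "x1 < x2" and y: "y1 < y2"
  shows "kernel_density x2 y1 * kernel_density x1 y2 \<le> kernel_density x1 y1 * kernel_density x2 y2"
proof (cases "y1 \<in> window x2 \<and> y2 \<in> window x1")
  case False
  then have "kernel_density x2 y1 * kernel_density x1 y2 = 0"
    using kernel_density_outside x by auto
  moreover have "0 \<le> kernel_density x1 y1 * kernel_density x2 y2"
    by (intro mult_nonneg_nonneg kernel_density_nonneg x)
  ultimately show ?thesis by (simp only:)
next
  case True
  have pos: "0 < mass {..x1} UNIV" using x by (simp add: regular_iff rng_iff)
  have y': "ereal y1 \<le> ereal y2" using y by simp
  have mono: "se x1 \<le> se x2" "nw x1 \<le> nw x2" using x(3) by (simp_all add: se_mono nw_mono)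
  have "y1 \<in> window x1" "y2 \<in> window x2"
    using True order_trans[OF mono(1), of "ereal y1"] order_trans[OF y', of "nw x1"]
      order_trans[OF _ y', of "se x2"] order_trans[OF _ mono(2), of "ereal y2"]
    unfolding window_def by blast+
  moreover have "cond_density (supp_left x2) y1 * cond_density (supp_left x1) y2
      \<le> cond_density (supp_left x1) y1 * cond_density (supp_left x2) y2"
  proof (cases "supp_left x1 = supp_left x2")
    case False
    then have "supp_left x1 < supp_left x2" using supp_left_mono[OF pos] x(3) by (simp add: less_le)
    then show ?thesis by (intro cond_density_TP2 two_sided_supp_left x y)
  qed simp
  ultimately show ?thesis
    using True wt_pos[OF x(1)] wt_pos[OF x(2)]
    by (simp add: kernel_density_def divide_simps mult.commute)
qed

section \<open>Agreement with the limit laws almost everywhere\<close>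

lemma AE_P_left_nbhd_pos: "AE x in P. \<forall>n. 0 < mass (left_nbhd n x) UNIV"
  unfolding AE_all_countable
proof
  fix n
  let ?E = "{x. measure P (left_nbhd n x) = 0}"
  note [measurable] = measurable_measure_left_nbhd[OF P.finite_measure_axioms]
  have E [measurable]: "?E \<in> sets borel" by measurable
  \<comment> \<open>If the \<open>n\<close>-th neighbourhood is null, so are all later ones; the
    comparison lemma therefore applies with factor 0 on the right.\<close>
  have "1 * measure P ?E \<le> 0 * measure P ?E"
  proof (rule scaled_measure_le_if_eventually_left_nbhd_le)
    fix x assume "x \<in> ?E"
    then have "measure P (left_nbhd m x) = 0" if "n \<le> m" for m
      using P.finite_measure_mono[OF left_nbhd_antimono[OF that, of x]] by (simp add: order_antisym)
    then show "\<forall>\<^sub>F m in sequentially. 1 * measure P (left_nbhd m x) \<le> 0 * measure P (left_nbhd m x)"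
      unfolding eventually_sequentially by (intro exI[of _ n]) simp
  qed (simp_all add: P.finite_measure_axioms)
  then have "P.prob ?E = 0" by (simp add: order_antisym)
  then have "AE x in P. x \<notin> ?E" by (subst (asm) P.prob_eq_0) auto
  then show "AE x in P. 0 < mass (left_nbhd n x) UNIV"
    by eventually_elim (simp add: measure_P less_le)
qed

text \<open>If \<open>supp_left x < x\<close>, small left neighbourhoods of \<open>x\<close> lie in
  the gap and are null, which happens only on a \<open>P\<close>-null set. Moving to the left end is
  thus invisible to the disintegration.\<close>

lemma AE_P_supp_left: "AE x in P. x \<in> rng \<longrightarrow> supp_left x = x"
  using AE_P_left_nbhd_pos
proof eventually_elim
  case (elim x)
  show ?case
  proof
    assume "x \<in> rng"
    then have pos: "0 < mass {..x} UNIV" by (simp add: rng_iff)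
    show "supp_left x = x"
    proof (rule ccontr)
      assume "supp_left x \<noteq> x"
      then have "supp_left x < x" using supp_left_le[OF pos] by simp
      then obtain n where "\<forall>z\<in>left_nbhd n x. supp_left x < z"
        using eventually_left_nbhd_gt unfolding eventually_sequentially by blast
      then have "left_nbhd n x \<subseteq> {supp_left x<..x}" by (auto simp: left_nbhd_def)
      then have "mass (left_nbhd n x) UNIV \<le> mass {supp_left x<..x} UNIV" by (intro mass_mono) auto
      then show False using elim mass_supp_left[OF pos] by (simp add: not_less[symmetric])
    qed
  qed
qed

text \<open>Almost surely \<open>Y\<close> is not below \<open>se X\<close>, so the integral of the
  conditional distribution function over the points with \<open>q < se x\<close> vanishes. This
  supplies, for almost every \<open>x\<close>, the lower bound that the limit law may lack at single
  points.\<close>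

lemma AE_P_cond_cdf_eq_0: "AE x in P. \<forall>q::rat. x \<in> regular \<and> ereal (real_of_rat q) < se x \<longrightarrow> cond_cdf x (real_of_rat q) = 0"
  unfolding AE_all_countable
proof
  fix q :: rat
  define D where "D = regular \<inter> {x. ereal (real_of_rat q) < se x}"
  have [measurable]: "D \<in> sets borel" by (simp add: D_def)
  note [measurable] = measurable_cond_cdf
  have "AE \<omega> in M. X \<omega> \<in> D \<longrightarrow> Y \<omega> \<notin> {..real_of_rat q}"
    using AE_Y_between
  proof eventually_elim
    case (elim \<omega>)
    show ?case
    proof
      assume "X \<omega> \<in> D"
      then have "ereal (real_of_rat q) < se (X \<omega>)" by (simp add: D_def)
      also have "\<dots> \<le> ereal (Y \<omega>)" using elim by simp
      finally show "Y \<omega> \<notin> {..real_of_rat q}" by simp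
    qed
  qed
  then have "mass D {..real_of_rat q} = 0" by (simp add: AE_iff_mass_eq_0)
  then have "(\<integral>\<^sup>+x\<in>D. ennreal (cond_cdf x (real_of_rat q)) \<partial>P) = 0"
    by (simp add: mass_eq_nn_integral_cond_cdf[symmetric])
  then have "AE x in P. ennreal (cond_cdf x (real_of_rat q)) * indicator D x = 0"
    by (subst (asm) nn_integral_0_iff_AE) auto
  then show "AE x in P. x \<in> regular \<and> ereal (real_of_rat q) < se x \<longrightarrow> cond_cdf x (real_of_rat q) = 0"
  proof eventually_elim
    case (elim x)
    then show ?case
      using cond_cdf_bounds(1)[of x "real_of_rat q"] by (auto simp: D_def ennreal_eq_0_iff)
  qed
qed

text \<open>For almost every regular \<open>x\<close> the corrections are void:
  \<open>supp_left x = x\<close>, and the limit law already lives on the window, so that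
  \<open>wt x = 1\<close>.\<close>

lemma AE_P_kernel_cdf:
  "AE x in P. x \<in> regular \<longrightarrow> emeasure (density Q (\<lambda>y. ennreal (kernel_density x y))) {..c} = ennreal (cond_cdf x c)"
  using AE_P_supp_left AE_P_cond_cdf_eq_0
proof eventually_elim
  case (elim x)
  show ?case
  proof
    assume x: "x \<in> regular"
    then have supp: "supp_left x = x" using elim by (simp add: regular_iff)
    have two: "two_sided x" using two_sided_supp_left[OF x] supp by simp
    then interpret K: real_distribution "cond_law x" by (rule real_distribution_cond_law)
    have "AE y in cond_law x. \<forall>q::rat. ereal (real_of_rat q) < se x \<longrightarrow> y \<notin> {..real_of_rat q}"
      unfolding AE_all_countable
    proof
      fix q :: rat
      show "AE y in cond_law x. ereal (real_of_rat q) < se x \<longrightarrow> y \<notin> {..real_of_rat q}"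
      proof (cases "ereal (real_of_rat q) < se x")
        case True
        then have "K.prob {..real_of_rat q} = 0"
          using elim(2) x by (simp add: measure_cond_law_Iic[OF two])
        then show ?thesis by (subst (asm) K.prob_eq_0) (auto elim: eventually_mono)
      qed simp
    qed
    moreover have "AE y in cond_law x. ereal y \<le> nw x" using AE_cond_law_le_nw[OF x] unfolding supp .
    ultimately have window: "AE y in cond_law x. y \<in> window x"
    proof eventually_elim
      case (elim y)
      have "se x \<le> ereal y"
      proof (rule ccontr)
        assume "\<not> se x \<le> ereal y"
        then have "ereal y < se x" by simp
        then obtain q where "ereal y < ereal (real_of_rat q)" "ereal (real_of_rat q) < se x"
          using ereal_dense3 by blast
        then show False using elim(1) by force
      qed
      then show ?case using elim by (simp add: window_def)
    qed
    then have "wt x = 1" unfolding wt_def supp by (subst K.prob_eq_1) auto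
    moreover have "K.prob ({..c} \<inter> window x) = K.prob {..c}"
      using window by (intro K.finite_measure_eq_AE) (auto elim: eventually_mono)
    ultimately show "emeasure (density Q (\<lambda>y. ennreal (kernel_density x y))) {..c} = ennreal (cond_cdf x c)"
      by (simp add: emeasure_kernel_density[OF x] supp measure_cond_law_Iic[OF two])
  qed
qed

end

section \<open>Assembling the kernel from the selection and the densities\<close>

locale tp2_selection = tp2_pair +
  fixes S :: "real \<Rightarrow> real"
  assumes S_mono: "mono_on (range_o M X Y) S"
    and S_between: "\<And>x. x \<in> range_o M X Y \<Longrightarrow> nw x \<le> ereal (S x) \<and> ereal (S x) \<le> se x"
begin

text \<open>Outside the range, a \<open>P\<close>-null set, the point mass at 0 is an arbitrary
  default that keeps the kernel a probability measure at every real.\<close>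

definition lr_kernel :: "real \<Rightarrow> real measure" where
  "lr_kernel x = (if x \<in> range_o M X Y then return borel (S x)
    else if x \<in> rng then density Q (\<lambda>y. ennreal (kernel_density x y))
    else return borel 0)"

lemma kernel_range_o: "x \<in> range_o M X Y \<Longrightarrow> lr_kernel x = return borel (S x)"
  by (simp add: lr_kernel_def)

lemma kernel_regular: "x \<in> regular \<Longrightarrow> lr_kernel x = density Q (\<lambda>y. ennreal (kernel_density x y))"
  by (simp add: lr_kernel_def regular_def)

lemma rng_cases:
  assumes "x \<in> rng"
  obtains "x \<in> range_o M X Y" | "x \<in> regular"
  using assms by (auto simp: regular_def)

lemma real_distribution_return: "real_distribution (return borel (c::real))"
  by (simp add: real_distribution_def real_distribution_axioms_def prob_space_return)

lemma real_distribution_kernel: "real_distribution (lr_kernel x)"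
  using real_distribution_kernel_density[of x] real_distribution_return
  by (simp add: lr_kernel_def regular_def)

lemma AE_kernel_range_o:
  assumes "x \<in> range_o M X Y"
  shows "AE y in lr_kernel x. y = S x"
  unfolding kernel_range_o[OF assms] by (simp add: AE_return)

lemma AE_kernel_regular:
  assumes "x \<in> regular"
  shows "AE y in lr_kernel x. se x \<le> ereal y \<and> ereal y \<le> nw x"
  using AE_kernel_density_window[OF assms] unfolding kernel_regular[OF assms] window_def by simp

text \<open>A point mass separates the two laws. For \<open>x1\<close> in \<open>range_o\<close> one
  has \<open>S x1 \<le> se x1 \<le> se x2\<close>, for \<open>x2\<close> in \<open>range_o\<close>
  one has \<open>nw x1 \<le> nw x2 \<le> S x2\<close>, and monotonicity of \<open>S\<close> covers
  the case of both. Two regular points have TP2 densities with respect to \<open>Q\<close>.\<close>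

lemma kernel_lr_le:
  assumes x: "x1 \<in> rng" "x2 \<in> rng" "x1 < x2"
  shows "lr_le (lr_kernel x1) (lr_kernel x2)"
proof -
  have mono: "se x1 \<le> se x2" "nw x1 \<le> nw x2" using x(3) by (simp_all add: se_mono nw_mono)
  show ?thesis
  proof (cases rule: rng_cases[OF x(1)])
    case o1: 1
    have "AE y in lr_kernel x2. S x1 \<le> y"
    proof (cases rule: rng_cases[OF x(2)])
      case 1
      then have "S x1 \<le> S x2" using S_mono o1 x(3) by (auto simp: mono_on_def)
      then show ?thesis using AE_kernel_range_o[OF 1] by (auto elim!: eventually_mono)
    next
      case 2
      have le: "ereal (S x1) \<le> se x2" using S_between[OF o1] mono(1) by (blast intro: order_trans)
      show ?thesis
        using AE_kernel_regular[OF 2]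
        by eventually_elim (use order_trans[OF le] in \<open>simp del: ereal_less_eq add: ereal_less_eq(3)[symmetric]\<close>)
    qed
    moreover have "AE y in lr_kernel x1. y \<le> S x1"
      using AE_kernel_range_o[OF o1] by (auto elim!: eventually_mono)
    ultimately show ?thesis by (intro lr_le_if_separated[of _ _ "S x1"] real_distribution_kernel)
  next
    case r1: 2
    show ?thesis
    proof (cases rule: rng_cases[OF x(2)])
      case o2: 1
      have le: "nw x1 \<le> ereal (S x2)" using S_between[OF o2] mono(2) by (blast intro: order_trans)
      have "AE y in lr_kernel x1. y \<le> S x2"
        using AE_kernel_regular[OF r1]
        by eventually_elim (use order_trans[OF _ le] in \<open>simp del: ereal_less_eq add: ereal_less_eq(3)[symmetric]\<close>)
      moreover have "AE y in lr_kernel x2. S x2 \<le> y"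
        using AE_kernel_range_o[OF o2] by (auto elim!: eventually_mono)
      ultimately show ?thesis by (intro lr_le_if_separated[of _ _ "S x2"] real_distribution_kernel)
    next
      case r2: 2
      show ?thesis
        unfolding kernel_regular[OF r1] kernel_regular[OF r2]
        by (intro lr_le_density Q.sigma_finite_measure_axioms sets_distr measurable_kernel_density
            kernel_density_nonneg kernel_density_TP2 r1 r2 x(3))
    qed
  qed
qed

text \<open>The likelihood ratio order makes the mass of \<open>{..c}\<close> decrease in
  \<open>x\<close> along the range, which gives measurability without examining how
  \<open>supp_left\<close> and \<open>wt\<close> vary with \<open>x\<close>. The sign in
  \<open>f\<close> turns it into an increasing function.\<close>

lemma measurable_lr_kernel: "lr_kernel \<in> borel \<rightarrow>\<^sub>M prob_algebra borel"
proof (rule measurable_prob_algebra_generated[where G = "range (\<lambda>c. {..c::real})" and \<Omega> = UNIV])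
  show "sets borel = sigma_sets UNIV (range (\<lambda>c. {..c::real}))"
    by (subst borel_eq_atMost) simp
  show "Int_stable (range (\<lambda>c. {..c::real}))"
    by (auto simp: Int_stable_def)
  fix x
  interpret K: real_distribution "lr_kernel x" by (rule real_distribution_kernel)
  show "prob_space (lr_kernel x)" by (rule K.prob_space_axioms)
  show "sets (lr_kernel x) = sets borel" by simp
next
  fix A :: "real set" assume "A \<in> range (\<lambda>c. {..c})"
  then obtain c where A: "A = {..c}" by blast
  define f where "f x = - measure (lr_kernel x) {..c}" for x
  have "mono_on rng f"
  proof (rule mono_onI)
    fix x y assume "x \<in> rng" "y \<in> rng" "x \<le> y"
    then show "f x \<le> f y"
      using lr_le_imp_cdf_le[OF real_distribution_kernel real_distribution_kernel kernel_lr_le, of x y c]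
      by (cases "x = y") (auto simp: f_def)
  qed
  then have [measurable]: "f \<in> borel_measurable (restrict_space borel rng)"
    by (rule borel_measurable_mono_on_fnc)
  have "f x = (if x \<in> rng then f x else - measure (return borel 0) {..c})" for x
    by (auto simp: f_def lr_kernel_def range_o_def)
  moreover have "(\<lambda>x. if x \<in> rng then f x else - measure (return borel 0) {..c}) \<in> borel_measurable borel"
    by (subst measurable_If_restrict_space_iff) auto
  ultimately have [measurable]: "f \<in> borel_measurable borel" by (simp cong: measurable_cong)
  have "emeasure (lr_kernel x) A = ennreal (- f x)" for x
  proof -
    interpret K: real_distribution "lr_kernel x" by (rule real_distribution_kernel)
    show ?thesis by (simp add: f_def A K.emeasure_eq_measure)
  qed
  then show "(\<lambda>x. emeasure (lr_kernel x) A) \<in> borel_measurable borel" by simp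
qed auto

lemma measurable_emeasure_kernel [measurable]:
  "B \<in> sets borel \<Longrightarrow> (\<lambda>x. emeasure (lr_kernel x) B) \<in> borel_measurable borel"
  using measurable_emeasure_kernel[OF measurable_prob_algebraD[OF measurable_lr_kernel]] by simp

text \<open>The two inequalities for \<open>S\<close> and those for \<open>Y\<close> run in opposite
  directions: \<open>nw \<le> S \<le> se\<close> and \<open>se \<le> Y \<le> nw\<close> at
  \<open>X\<close>.\<close>

lemma AE_Y_eq_S: "AE \<omega> in M. X \<omega> \<in> range_o M X Y \<longrightarrow> Y \<omega> = S (X \<omega>)"
  using AE_Y_between
proof eventually_elim
  case (elim \<omega>)
  show ?case
  proof
    assume "X \<omega> \<in> range_o M X Y"
    from S_between[OF this] elim have "ereal (S (X \<omega>)) \<le> ereal (Y \<omega>)" "ereal (Y \<omega>) \<le> ereal (S (X \<omega>))"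
      by (blast intro: order_trans)+
    then show "Y \<omega> = S (X \<omega>)" by simp
  qed
qed

lemma mass_range_o_kernel:
  assumes [measurable]: "A \<in> sets borel" and B [measurable]: "B \<in> sets borel"
  shows "ennreal (mass (A \<inter> range_o M X Y) B) = (\<integral>\<^sup>+x\<in>A \<inter> range_o M X Y. emeasure (lr_kernel x) B \<partial>P)"
proof -
  let ?D = "A \<inter> range_o M X Y"
  have "(\<integral>\<^sup>+x\<in>?D. emeasure (lr_kernel x) B \<partial>P) = (\<integral>\<^sup>+\<omega>. emeasure (lr_kernel (X \<omega>)) B * indicator ?D (X \<omega>) \<partial>M)"
    by (subst nn_integral_distr) auto
  also have "\<dots> = (\<integral>\<^sup>+\<omega>. indicator {\<omega> \<in> space M. X \<omega> \<in> ?D \<and> Y \<omega> \<in> B} \<omega> \<partial>M)"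
    using AE_Y_eq_S AE_space
    by (intro nn_integral_cong_AE, eventually_elim) (auto simp: kernel_range_o indicator_def)
  also have "\<dots> = ennreal (mass ?D B)"
    by (subst nn_integral_indicator) (auto simp: mass_def emeasure_eq_measure)
  finally show ?thesis by simp
qed

lemma mass_Iic_kernel:
  assumes [measurable]: "A \<in> sets borel"
  shows "ennreal (mass A {..c}) = (\<integral>\<^sup>+x\<in>A. emeasure (lr_kernel x) {..c} \<partial>P)"
proof -
  let ?D = "A \<inter> range_o M X Y" and ?E = "A \<inter> regular" and ?N = "A - rng"
  have sets: "?D \<in> sets borel" "?E \<in> sets borel" "?N \<in> sets borel" by measurable
  have "mass ?N UNIV = 0"
    using AE_X_in_rng by (subst AE_iff_mass_eq_0) (auto elim: eventually_mono)
  then have N: "mass ?N {..c} = 0"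
    using mass_mono[of ?N UNIV ?N "{..c}"] by (simp add: order_antisym)
  have AE_rng: "AE x in P. x \<in> rng" using AE_X_in_rng by (subst AE_distr_iff) auto
  have E: "ennreal (mass ?E {..c}) = (\<integral>\<^sup>+x\<in>?E. emeasure (lr_kernel x) {..c} \<partial>P)"
  proof -
    have "ennreal (mass ?E {..c}) = (\<integral>\<^sup>+x\<in>?E. ennreal (cond_cdf x c) \<partial>P)"
      by (rule mass_eq_nn_integral_cond_cdf) simp
    also have "\<dots> = (\<integral>\<^sup>+x\<in>?E. emeasure (lr_kernel x) {..c} \<partial>P)"
      using AE_P_kernel_cdf[of c]
      by (intro nn_integral_cong_AE, eventually_elim) (auto simp: indicator_def kernel_regular)
    finally show ?thesis .
  qed
  have "A = ?D \<union> ?E \<union> ?N" by (auto simp: regular_def)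
  moreover have "mass (?D \<union> ?E \<union> ?N) {..c} = mass (?D \<union> ?E) {..c} + mass ?N {..c}"
    by (intro mass_Un_left sets.Un sets) (auto simp: regular_def range_o_def)
  moreover have "mass (?D \<union> ?E) {..c} = mass ?D {..c} + mass ?E {..c}"
    by (intro mass_Un_left sets) (auto simp: regular_def)
  ultimately have "mass A {..c} = mass ?D {..c} + mass ?E {..c}" using N by simp
  then have "ennreal (mass A {..c}) = (\<integral>\<^sup>+x\<in>?D. emeasure (lr_kernel x) {..c} \<partial>P) + (\<integral>\<^sup>+x\<in>?E. emeasure (lr_kernel x) {..c} \<partial>P)"
    by (simp add: ennreal_plus mass_range_o_kernel[symmetric] E[symmetric])
  also have "\<dots> = (\<integral>\<^sup>+x. emeasure (lr_kernel x) {..c} * indicator ?D x + emeasure (lr_kernel x) {..c} * indicator ?E x \<partial>P)"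
    by (intro nn_integral_add[symmetric]) auto
  also have "\<dots> = (\<integral>\<^sup>+x\<in>A. emeasure (lr_kernel x) {..c} \<partial>P)"
    using AE_rng
    by (intro nn_integral_cong_AE, eventually_elim) (auto simp: indicator_def regular_def)
  finally show ?thesis .
qed

text \<open>Half-lines are an intersection-stable generator of the Borel sets, so the identity known
  for \<open>{..c}\<close> extends to every \<open>B\<close> by Dynkin's argument, with
  \<open>A\<close> held fixed.\<close>

lemma joint_distr_kernel:
  assumes [measurable]: "A \<in> sets borel" and B: "B \<in> sets borel"
  shows "emeasure (joint_distr M X Y) (A \<times> B) = (\<integral>\<^sup>+x\<in>A. emeasure (lr_kernel x) B \<partial>P)"
proof -
  have K: "real_distribution (lr_kernel x)" for x by (rule real_distribution_kernel)
  have "sets (borel :: real measure) = sigma_sets UNIV (range (\<lambda>c. {..c::real}))"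
    by (subst borel_eq_atMost) simp
  with B have B: "B \<in> sigma_sets UNIV (range (\<lambda>c. {..c}))" by simp
  have "Int_stable (range (\<lambda>c. {..c::real}))" by (auto simp: Int_stable_def)
  moreover have "range (\<lambda>c. {..c::real}) \<subseteq> Pow UNIV" by simp
  ultimately show ?thesis using B
  proof (induction rule: sigma_sets_induct_disjoint)
    case (basic B)
    then show ?case by (auto simp: emeasure_joint_distr mass_Iic_kernel)
  next
    case empty
    show ?case by simp
  next
    case (compl B)
    have [measurable]: "B \<in> sets borel"
      using compl(1) by (subst borel_eq_atMost) simp
    have le: "emeasure (lr_kernel x) B \<le> 1" for x
    proof -
      interpret K: real_distribution "lr_kernel x" by (rule K)
      show ?thesis by (rule K.measure_le_1)
    qed
    have "B \<union> (UNIV - B) = UNIV" by auto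
    then have "mass A UNIV = mass A B + mass A (UNIV - B)"
      using mass_Un_right[of A B "UNIV - B"] by simp
    then have "emeasure (joint_distr M X Y) (A \<times> (UNIV - B)) = ennreal (mass A UNIV) - ennreal (mass A B)"
      by (simp add: emeasure_joint_distr ennreal_minus)
    also have "ennreal (mass A UNIV) = (\<integral>\<^sup>+x. indicator A x \<partial>P)"
      by (simp add: P.emeasure_eq_measure measure_P del: emeasure_distr)
    also have "ennreal (mass A B) = (\<integral>\<^sup>+x\<in>A. emeasure (lr_kernel x) B \<partial>P)"
      using compl(2) by (simp add: emeasure_joint_distr)
    also have "(\<integral>\<^sup>+x. indicator A x \<partial>P) - \<dots> = (\<integral>\<^sup>+x. indicator A x - emeasure (lr_kernel x) B * indicator A x \<partial>P)"
    \<comment> \<open>Subtraction in \<open>ennreal\<close> needs the subtracted integral to be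
      finite; by the induction hypothesis it is the mass of a rectangle.\<close>
    proof (rule nn_integral_diff[symmetric])
      have "(\<integral>\<^sup>+x\<in>A. emeasure (lr_kernel x) B \<partial>P) = ennreal (mass A B)"
        using compl(2) by (simp add: emeasure_joint_distr)
      then show "(\<integral>\<^sup>+x\<in>A. emeasure (lr_kernel x) B \<partial>P) \<noteq> \<infinity>" by simp
      show "AE x in P. emeasure (lr_kernel x) B * indicator A x \<le> indicator A x"
        using le by (auto simp: indicator_def)
    qed auto
    also have "\<dots> = (\<integral>\<^sup>+x\<in>A. emeasure (lr_kernel x) (UNIV - B) \<partial>P)"
    proof (intro nn_integral_cong)
      fix x
      interpret K: real_distribution "lr_kernel x" by (rule K)
      show "indicator A x - emeasure (lr_kernel x) B * indicator A x = emeasure (lr_kernel x) (UNIV - B) * indicator A x"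
        using emeasure_compl[of B "lr_kernel x"] K.emeasure_space_1 by (simp add: indicator_def)
    qed
    finally show ?case .
  next
    case (union F)
    have F [measurable]: "F i \<in> sets borel" for i
      using union(2) by (subst borel_eq_atMost) auto
    have "emeasure (joint_distr M X Y) (A \<times> (\<Union>i. F i)) = emeasure (joint_distr M X Y) (\<Union>i. A \<times> F i)"
      by (rule arg_cong[where f = "emeasure (joint_distr M X Y)"]) auto
    also have "\<dots> = (\<Sum>i. emeasure (joint_distr M X Y) (A \<times> F i))"
      using union(1) by (intro suminf_emeasure[symmetric])
        (auto simp: joint_distr_def disjoint_family_on_def)
    also have "\<dots> = (\<Sum>i. \<integral>\<^sup>+x\<in>A. emeasure (lr_kernel x) (F i) \<partial>P)" using union(3) by simp
    also have "\<dots> = (\<integral>\<^sup>+x. (\<Sum>i. emeasure (lr_kernel x) (F i) * indicator A x) \<partial>P)"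
      by (intro nn_integral_suminf[symmetric]) simp
    also have "\<dots> = (\<integral>\<^sup>+x\<in>A. emeasure (lr_kernel x) (\<Union>i. F i) \<partial>P)"
    proof (intro nn_integral_cong)
      fix x
      interpret K: real_distribution "lr_kernel x" by (rule K)
      show "(\<Sum>i. emeasure (lr_kernel x) (F i) * indicator A x) = emeasure (lr_kernel x) (\<Union>i. F i) * indicator A x"
        using suminf_emeasure[of F "lr_kernel x"] union(1) F by (simp add: image_subset_iff)
    qed
    finally show ?case .
  qed
qed

lemma cond_distr_kernel: "cond_distr_kernel M X Y lr_kernel"
  unfolding cond_distr_kernel_def using measurable_lr_kernel joint_distr_kernel by blast

end

theorem theorem18:
  fixes M :: "'a measure" and X Y :: "'a \<Rightarrow> real" and S :: "real \<Rightarrow> real"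
  assumes "prob_space M"
    and "X \<in> borel_measurable M" and "Y \<in> borel_measurable M"
    and "TP2_distribution (joint_distr M X Y)"
    and "mono_on (range_o M X Y) S"
    and "\<And>x. x \<in> range_o M X Y \<Longrightarrow>
           S_nw M X Y x \<le> ereal (S x) \<and> ereal (S x) \<le> S_se M X Y x"
  shows "\<exists>K. cond_distr_kernel M X Y K \<and>
    (\<forall>x1\<in>rv_range M X. \<forall>x2\<in>rv_range M X. x1 < x2 \<longrightarrow> lr_le (K x1) (K x2)) \<and>
    (\<forall>x\<in>range_o M X Y. K x = return borel (S x)) \<and>
    (\<exists>h :: real \<Rightarrow> real \<Rightarrow> real.
       (\<forall>x\<in>rv_range M X - range_o M X Y.
          h x \<in> borel_measurable borel \<and> (\<forall>y. 0 \<le> h x y) \<and> (\<exists>C. \<forall>y. h x y \<le> C) \<and>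
          K x = density (distr M borel Y) (\<lambda>y. ennreal (h x y)) \<and>
          (\<forall>y. ereal y < S_se M X Y x \<or> ereal y > S_nw M X Y x \<longrightarrow> h x y = 0)) \<and>
       (\<forall>x1\<in>rv_range M X - range_o M X Y. \<forall>x2\<in>rv_range M X - range_o M X Y. \<forall>y1 y2.
          x1 < x2 \<longrightarrow> y1 < y2 \<longrightarrow> h x2 y1 * h x1 y2 \<le> h x1 y1 * h x2 y2))"
proof -
  interpret tp2_selection M X Y S
    using assms by (simp add: tp2_selection_def tp2_pair_def tp2_pair_axioms_def tp2_selection_axioms_def)
  show ?thesis
  proof (intro exI[of _ lr_kernel] exI[of _ kernel_density] conjI ballI allI impI)
    fix x assume "x \<in> rng - range_o M X Y"
    then have x: "x \<in> regular" by (simp add: regular_def)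
    show "kernel_density x \<in> borel_measurable borel" by (rule measurable_kernel_density[OF x])
    show "0 \<le> kernel_density x y" for y by (rule kernel_density_nonneg[OF x])
    show "\<exists>C. \<forall>y. kernel_density x y \<le> C" by (rule kernel_density_bounded[OF x])
    show "lr_kernel x = density Q (\<lambda>y. ennreal (kernel_density x y))" by (rule kernel_regular[OF x])
    fix y assume "ereal y < se x \<or> nw x < ereal y"
    then show "kernel_density x y = 0" using kernel_density_outside[OF x] by (auto simp: window_def not_le)
  next
    fix x1 x2 y1 y2
    assume "x1 \<in> rng - range_o M X Y" "x2 \<in> rng - range_o M X Y" "x1 < x2" "y1 < (y2::real)"
    then show "kernel_density x2 y1 * kernel_density x1 y2 \<le> kernel_density x1 y1 * kernel_density x2 y2"
      by (intro kernel_density_TP2) (auto simp: regular_def)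
  qed (use cond_distr_kernel kernel_lr_le kernel_range_o in blast)+
qed

end
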